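(* Let $(E,T,S,e)$ be a conditional expectation preserving system. Then $S$ has a unique order continuous Riesz homomorphism extension to $L^{1}(T)$, i.e. there is a unique order continuous Riesz homomorphism $L^1(T)\to L^1(T)$, denoted again by $S$, whose restriction to $E$ is the given $S$; moreover this extension fulfills $TS=T$ on $L^1(T)$.
   Context: A conditional Riesz triple $(E,e,T)$ consists of a Dedekind complete Riesz space $E$, a weak order unit $e$ of $E$, and a conditional expectation operator $T$ on $E$, that is, a strictly positive order continuous linear projection $T:E\to E$ with $Te=e$ and Dedekind complete range $R(T)$. A conditional expectation preserving system is a 4-tuple $(E,T,S,e)$ where $(E,e,T)$ is a conditional Riesz triple and $S:E\to E$ is an order continuous Riesz (lattice) homomorphism with $Se=e$ and $TSf=Tf$ for all $f\in E$. Let $E^u$ be the universal completion of $E$. The natural domain of $T$ is $L^1(T)=D-D\subseteq E^u$, where $D$ is the set of $x\in E^u_+$ for which there is a net $(x_\alpha)$ in $E_+$ with $0\le x_\alpha\uparrow x$ and $(Tx_\alpha)$ order bounded in $E^u$. The operator $T$ is extended to $L^1(T)$ by $Tx=\sup_\alpha Tx_\alpha$ for $x\in D$ with $(x_\alpha)$ such a net, and by linearity; this extension, again denoted $T$, is a conditional expectation operator on $L^1(T)$. *)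

theory Defs
  imports Complex_Main "HOL-Library.Lattice_Algebras" "HOL-Library.Lub_Glb"
begin

class riesz_space = ordered_real_vector + lattice_ab_group_add_abs

text \<open>
  Riesz spaces are carrier sets inside an ambient Riesz space. Suprema and infima
  are always relative to the carrier: \<^term>\<open>isLub A X s\<close> says that \<^term>\<open>s\<close> is the
  supremum of \<^term>\<open>X\<close> computed in \<^term>\<open>A\<close>.
\<close>

definition riesz_subspace :: "'a::riesz_space set \<Rightarrow> bool" where
  "riesz_subspace A \<longleftrightarrow>
     subspace A \<and> (\<forall>x\<in>A. \<forall>y\<in>A. sup x y \<in> A \<and> inf x y \<in> A)"

definition dedekind_complete :: "'a::order set \<Rightarrow> bool" where
  "dedekind_complete A \<longleftrightarrow>
     (\<forall>X. X \<subseteq> A \<and> X \<noteq> {} \<and> (\<exists>b. isUb A X b) \<longrightarrow> (\<exists>s. isLub A X s))"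

definition weak_order_unit :: "'a::riesz_space set \<Rightarrow> 'a \<Rightarrow> bool" where
  "weak_order_unit A e \<longleftrightarrow>
     e \<in> A \<and> 0 \<le> e \<and> (\<forall>x\<in>A. inf \<bar>x\<bar> e = 0 \<longrightarrow> x = 0)"

definition up_directed :: "'a::order set \<Rightarrow> bool" where
  "up_directed X \<longleftrightarrow> X \<noteq> {} \<and> (\<forall>x\<in>X. \<forall>y\<in>X. \<exists>z\<in>X. x \<le> z \<and> y \<le> z)"

definition down_directed :: "'a::order set \<Rightarrow> bool" where
  "down_directed X \<longleftrightarrow> X \<noteq> {} \<and> (\<forall>x\<in>X. \<forall>y\<in>X. \<exists>z\<in>X. z \<le> x \<and> z \<le> y)"

text \<open>
  Order convergence of a net in \<^term>\<open>A\<close>, the net being represented by its filter of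
  tails \<^term>\<open>F\<close> and the dominating net decreasing to \<open>0\<close> by its range \<^term>\<open>Y\<close>.
  The filter of tails of the image net is \<^term>\<open>filtermap f F\<close>, and every filter is
  the filter of tails of some net, so \<open>order_continuous_on\<close> quantifies over all nets
  without fixing a type of indices.
\<close>

definition order_converges :: "'a::riesz_space set \<Rightarrow> 'a filter \<Rightarrow> 'a \<Rightarrow> bool" where
  "order_converges A F x \<longleftrightarrow> x \<in> A \<and>
     (\<exists>Y. Y \<subseteq> A \<and> down_directed Y \<and> isGlb A Y 0 \<and>
          (\<forall>y\<in>Y. eventually (\<lambda>z. z \<in> A \<and> \<bar>z - x\<bar> \<le> y) F))"

definition order_continuous_on ::
    "'a::riesz_space set \<Rightarrow> 'b::riesz_space set \<Rightarrow> ('a \<Rightarrow> 'b) \<Rightarrow> bool" where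
  "order_continuous_on A B f \<longleftrightarrow>
     (\<forall>F x. order_converges A F x \<longrightarrow> order_converges B (filtermap f F) (f x))"

definition linear_map_on ::
    "'a::real_vector set \<Rightarrow> 'b::real_vector set \<Rightarrow> ('a \<Rightarrow> 'b) \<Rightarrow> bool" where
  "linear_map_on A B f \<longleftrightarrow> f ` A \<subseteq> B \<and>
     (\<forall>x\<in>A. \<forall>y\<in>A. f (x + y) = f x + f y) \<and> (\<forall>c. \<forall>x\<in>A. f (c *\<^sub>R x) = c *\<^sub>R f x)"

definition riesz_hom_on ::
    "'a::riesz_space set \<Rightarrow> 'b::riesz_space set \<Rightarrow> ('a \<Rightarrow> 'b) \<Rightarrow> bool" where
  "riesz_hom_on A B f \<longleftrightarrow> linear_map_on A B f \<and>
     (\<forall>x\<in>A. \<forall>y\<in>A. f (sup x y) = sup (f x) (f y) \<and> f (inf x y) = inf (f x) (f y))"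

definition conditional_expectation_on ::
    "'a::riesz_space set \<Rightarrow> 'a \<Rightarrow> ('a \<Rightarrow> 'a) \<Rightarrow> bool" where
  "conditional_expectation_on E e T \<longleftrightarrow>
     linear_map_on E E T \<and> (\<forall>x\<in>E. 0 < x \<longrightarrow> 0 < T x) \<and> order_continuous_on E E T \<and>
     (\<forall>x\<in>E. T (T x) = T x) \<and> T e = e \<and> dedekind_complete (T ` E)"

definition conditional_riesz_triple ::
    "'a::riesz_space set \<Rightarrow> 'a \<Rightarrow> ('a \<Rightarrow> 'a) \<Rightarrow> bool" where
  "conditional_riesz_triple E e T \<longleftrightarrow>
     riesz_subspace E \<and> dedekind_complete E \<and> weak_order_unit E e \<and>
     conditional_expectation_on E e T"

definition conditional_expectation_preserving_system ::
    "'a::riesz_space set \<Rightarrow> ('a \<Rightarrow> 'a) \<Rightarrow> ('a \<Rightarrow> 'a) \<Rightarrow> 'a \<Rightarrow> bool" where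
  "conditional_expectation_preserving_system E T S e \<longleftrightarrow>
     conditional_riesz_triple E e T \<and>
     riesz_hom_on E E S \<and> order_continuous_on E E S \<and>
     S e = e \<and> (\<forall>f\<in>E. T (S f) = T f)"

text \<open>
  Nonemptiness of \<^term>\<open>X\<close> matters: in a nontrivial Riesz space the empty set has no
  supremum.
\<close>

definition laterally_complete :: "'a::riesz_space set \<Rightarrow> bool" where
  "laterally_complete A \<longleftrightarrow>
     (\<forall>X. X \<subseteq> A \<and> X \<noteq> {} \<and> (\<forall>x\<in>X. 0 \<le> x) \<and> (\<forall>x\<in>X. \<forall>y\<in>X. x \<noteq> y \<longrightarrow> inf x y = 0)
        \<longrightarrow> (\<exists>s. isLub A X s))"

definition universally_complete :: "'a::riesz_space set \<Rightarrow> bool" where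
  "universally_complete A \<longleftrightarrow> dedekind_complete A \<and> laterally_complete A"

definition order_dense_in :: "'a::riesz_space set \<Rightarrow> 'a set \<Rightarrow> bool" where
  "order_dense_in E A \<longleftrightarrow> (\<forall>x\<in>A. 0 < x \<longrightarrow> (\<exists>y\<in>E. 0 < y \<and> y \<le> x))"

text \<open>
  The universal completion of \<^term>\<open>E\<close> is determined up to isomorphism; it is realised
  as the whole ambient type, with \<^term>\<open>E\<close> identified with its canonical copy.
\<close>

definition ambient_is_universal_completion :: "'a::riesz_space set \<Rightarrow> bool" where
  "ambient_is_universal_completion E \<longleftrightarrow>
     riesz_subspace E \<and> universally_complete (UNIV :: 'a set) \<and> order_dense_in E UNIV"

text \<open>
  In the next three definitions an increasing net in the positive cone of \<^term>\<open>E\<close> is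
  represented by its range \<^term>\<open>X\<close>, an upward directed set; suprema and order bounds are
  taken in the ambient universal completion.
\<close>

definition approximating ::
    "'a::riesz_space set \<Rightarrow> ('a \<Rightarrow> 'a) \<Rightarrow> 'a set \<Rightarrow> 'a \<Rightarrow> bool" where
  "approximating E T X x \<longleftrightarrow>
     X \<subseteq> E \<and> (\<forall>y\<in>X. 0 \<le> y) \<and> up_directed X \<and> isLub UNIV X x \<and>
     (\<exists>a b. T ` X \<subseteq> {a..b})"

definition natural_domain_pos :: "'a::riesz_space set \<Rightarrow> ('a \<Rightarrow> 'a) \<Rightarrow> 'a set" where
  "natural_domain_pos E T = {x. 0 \<le> x \<and> (\<exists>X. approximating E T X x)}"

definition natural_domain :: "'a::riesz_space set \<Rightarrow> ('a \<Rightarrow> 'a) \<Rightarrow> 'a set" where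
  "natural_domain E T =
     {u - v |u v. u \<in> natural_domain_pos E T \<and> v \<in> natural_domain_pos E T}"

definition extend_pos :: "'a::riesz_space set \<Rightarrow> ('a \<Rightarrow> 'a) \<Rightarrow> 'a \<Rightarrow> 'a" where
  "extend_pos E T x = (THE s. \<exists>X. approximating E T X x \<and> isLub UNIV (T ` X) s)"

definition extend :: "'a::riesz_space set \<Rightarrow> ('a \<Rightarrow> 'a) \<Rightarrow> 'a \<Rightarrow> 'a" where
  "extend E T x =
     (THE y. \<exists>u\<in>natural_domain_pos E T. \<exists>v\<in>natural_domain_pos E T.
        x = u - v \<and> y = extend_pos E T u - extend_pos E T v)"

definition order_continuous_riesz_hom_extension ::
    "'a::riesz_space set \<Rightarrow> 'a set \<Rightarrow> ('a \<Rightarrow> 'a) \<Rightarrow> ('a \<Rightarrow> 'a) \<Rightarrow> bool" where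
  "order_continuous_riesz_hom_extension E L S S' \<longleftrightarrow>
     riesz_hom_on L L S' \<and> order_continuous_on L L S' \<and> (\<forall>x\<in>E. S' x = S x)"

end

(* On a positive x of the universal completion, S is extended by the supremum of S y over the
   y in E with 0 <= y <= x. If x is in the natural domain, the set of these S y is T-bounded, since
   T S = T. A T-bounded directed set X in the positive cone of E is order bounded in the universal
   completion: a u > 0 whose multiples n u are all suprema of truncations x /\ n u would satisfy
   n T u <= b for all n, and without such u the set X can be bounded band by band. Additivity comes
   from E being an ideal (Riesz decomposition), the lattice and continuity properties from the
   infinite distributive law, and uniqueness from x being the supremum of the y above. *)

theory Submission
  imports Defs
begin

section \<open>Suprema in Riesz spaces\<close>

text \<open>The obstacle is that a bound on the averages \<open>T (S y)\<close> is not by itself a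
  bound on the \<open>S y\<close>. For directed families in the positive cone of \<open>E\<close>
  strict positivity of \<open>T\<close> supplies one, but only in the universal completion: the
  family may grow differently on different bands, which is why lateral completeness enters. Once
  this is known, \<open>T\<close> and \<open>S\<close> are extended by the same construction, which
  works for any positive order continuous operator on \<open>E\<close>. The extended
  \<open>S\<close> maps the natural domain into itself because the \<open>S y\<close> increase to
  its value at \<open>x\<close>, while their images under \<open>T\<close> are just the
  \<open>T y\<close>. Order convergence is defined relative to a carrier. Order density of the
  carriers makes the relevant suprema and infima agree with those of the ambient space, so the
  arguments can be run with suprema in \<open>UNIV\<close>.\<close>

lemma isLub_UNIV_iff:
  "isLub UNIV X s \<longleftrightarrow> (\<forall>x\<in>X. x \<le> s) \<and> (\<forall>b. (\<forall>x\<in>X. x \<le> b) \<longrightarrow> s \<le> b)"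
  by (auto simp: isLub_def leastP_def isUb_def setle_def setge_def)

lemma isLub_UNIV_least: "isLub UNIV X s \<Longrightarrow> (\<And>x. x \<in> X \<Longrightarrow> x \<le> b) \<Longrightarrow> s \<le> b"
  unfolding isLub_UNIV_iff by blast

lemma isLub_UNIV_unique:
  fixes s t :: "'a::order"
  shows "isLub UNIV X s \<Longrightarrow> isLub UNIV X t \<Longrightarrow> s = t"
  by (meson antisym isLub_UNIV_iff)

lemma dedekind_complete_UNIV_isLub:
  assumes "dedekind_complete (UNIV :: 'a::order set)" "X \<noteq> {}" "\<And>x. x \<in> X \<Longrightarrow> x \<le> (b::'a)"
  shows "\<exists>s. isLub UNIV X s"
  using assms unfolding dedekind_complete_def isUb_def setle_def by blast

lemma riesz_subspaceD:
  assumes "riesz_subspace A"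
  shows "0 \<in> A" "x \<in> A \<Longrightarrow> y \<in> A \<Longrightarrow> x + y \<in> A" "x \<in> A \<Longrightarrow> y \<in> A \<Longrightarrow> x - y \<in> A"
    "x \<in> A \<Longrightarrow> c *\<^sub>R x \<in> A" "x \<in> A \<Longrightarrow> - x \<in> A"
    "x \<in> A \<Longrightarrow> y \<in> A \<Longrightarrow> sup x y \<in> A" "x \<in> A \<Longrightarrow> y \<in> A \<Longrightarrow> inf x y \<in> A"
  using assms unfolding riesz_subspace_def
  by (auto intro: subspace_0 subspace_add subspace_diff subspace_scale subspace_neg)

lemma add_isLub:
  fixes s t :: "'a::riesz_space"
  assumes "isLub UNIV X s" "isLub UNIV Y t"
  shows "isLub UNIV {x + y |x y. x \<in> X \<and> y \<in> Y} (s + t)"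
  unfolding isLub_UNIV_iff
proof (intro conjI allI impI ballI)
  fix b assume b: "\<forall>z\<in>{x + y |x y. x \<in> X \<and> y \<in> Y}. z \<le> b"
  have "s \<le> b - y" if "y \<in> Y" for y
  proof -
    have "\<forall>x\<in>X. x \<le> b - y" using b that unfolding le_diff_eq by blast
    then show ?thesis using assms(1) unfolding isLub_UNIV_iff by blast
  qed
  then have "\<forall>y\<in>Y. y \<le> b - s" by (metis add.commute le_diff_eq)
  then have "t \<le> b - s" using assms(2) unfolding isLub_UNIV_iff by blast
  then show "s + t \<le> b" by (metis add.commute le_diff_eq)
qed (use assms in \<open>auto simp: isLub_UNIV_iff intro!: add_mono\<close>)

text \<open>The identity \<open>x + a = sup x a + inf x a\<close> turns a bound \<open>b\<close> on
  the truncations into the bound \<open>b + sup s a - a\<close> on \<open>X\<close>, since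
  \<open>sup x a\<close> is at most \<open>sup s a\<close>.\<close>

lemma inf_isLub:
  fixes s :: "'a::riesz_space"
  assumes "isLub UNIV X s"
  shows "isLub UNIV ((\<lambda>x. inf x a) ` X) (inf s a)"
  unfolding isLub_UNIV_iff
proof (intro conjI allI impI ballI)
  fix b assume b: "\<forall>z\<in>(\<lambda>x. inf x a) ` X. z \<le> b"
  have "x \<le> b + sup s a - a" if "x \<in> X" for x
  proof -
    have "x + a = sup x a + inf x a" by (rule add_eq_inf_sup)
    also have "\<dots> \<le> sup s a + b"
      using b that assms by (intro add_mono) (auto simp: isLub_UNIV_iff intro: le_supI1)
    finally show ?thesis by (simp add: le_diff_eq add.commute)
  qed
  then have "s \<le> b + sup s a - a"
    using assms by (auto simp: isLub_UNIV_iff)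
  then have "s + a \<le> sup s a + b" by (simp add: le_diff_eq add.commute)
  then show "inf s a \<le> b" unfolding add_eq_inf_sup[of s a] by simp
qed (use assms in \<open>auto simp: isLub_UNIV_iff intro: le_infI1\<close>)

lemma inf_sup_distrib_riesz:
  fixes x y z :: "'a::riesz_space"
  shows "inf (sup x y) z = sup (inf x z) (inf y z)"
proof -
  have "isLub UNIV {x, y} (sup x y)" by (auto simp: isLub_UNIV_iff)
  from inf_isLub[OF this, of z] have "isLub UNIV {inf x z, inf y z} (inf (sup x y) z)" by simp
  moreover have "isLub UNIV {inf x z, inf y z} (sup (inf x z) (inf y z))"
    by (auto simp: isLub_UNIV_iff simp del: inf_le1 inf_le2 intro: le_supI1 le_supI2)
  ultimately show ?thesis by (rule isLub_UNIV_unique)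
qed

lemma inf_isLub_isLub:
  fixes s t :: "'a::riesz_space"
  assumes "isLub UNIV X s" "isLub UNIV Y t"
  shows "isLub UNIV {inf x y |x y. x \<in> X \<and> y \<in> Y} (inf s t)"
  unfolding isLub_UNIV_iff
proof (intro conjI allI impI ballI)
  fix b assume b: "\<forall>z\<in>{inf x y |x y. x \<in> X \<and> y \<in> Y}. z \<le> b"
  have "inf s y \<le> b" if "y \<in> Y" for y
    using b that inf_isLub[OF assms(1), of y] unfolding isLub_UNIV_iff by force
  then have "inf t s \<le> b"
    using inf_isLub[OF assms(2), of s] unfolding isLub_UNIV_iff by (force simp: inf.commute)
  then show "inf s t \<le> b" by (simp add: inf.commute)
qed (use assms in \<open>auto simp: isLub_UNIV_iff intro: le_infI1 le_infI2\<close>)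

lemma scaleR_isLub:
  fixes s :: "'a::riesz_space"
  assumes "isLub UNIV X s" "0 < c"
  shows "isLub UNIV ((*\<^sub>R) c ` X) (c *\<^sub>R s)"
  unfolding isLub_UNIV_iff
proof (intro conjI allI impI ballI)
  fix b assume "\<forall>z\<in>(*\<^sub>R) c ` X. z \<le> b"
  then have "\<forall>x\<in>X. x \<le> b /\<^sub>R c" using assms(2) by (simp add: pos_le_divideR_eq)
  then have "s \<le> b /\<^sub>R c" using assms(1) by (auto simp: isLub_UNIV_iff)
  then show "c *\<^sub>R s \<le> b" using assms(2) by (simp add: pos_le_divideR_eq)
qed (use assms in \<open>auto simp: isLub_UNIV_iff intro: scaleR_left_mono\<close>)

lemma scaleR_inf_pos:
  fixes x y :: "'a::riesz_space"
  assumes "0 < c"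
  shows "c *\<^sub>R inf x y = inf (c *\<^sub>R x) (c *\<^sub>R y)"
proof (rule antisym)
  have "inf (c *\<^sub>R x) (c *\<^sub>R y) /\<^sub>R c \<le> inf x y"
    using assms by (simp add: pos_divideR_le_eq)
  then show "inf (c *\<^sub>R x) (c *\<^sub>R y) \<le> c *\<^sub>R inf x y"
    using assms by (metis pos_divideR_le_eq)
qed (use assms in \<open>simp add: scaleR_left_mono\<close>)

lemma inf_scaleR_eq_0:
  fixes x y :: "'a::riesz_space"
  assumes "inf x y = 0" "0 \<le> c"
  shows "inf x (c *\<^sub>R y) = 0"
proof (rule antisym)
  have nonneg: "0 \<le> x" "0 \<le> y" using assms(1) by (metis inf_le1, metis inf_le2)
  \<comment> \<open>A common factor can be pulled out of the infimum; it has to be at least 1 to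
    dominate \<open>x\<close> and at least \<open>c\<close> to dominate
    \<open>c *\<^sub>R y\<close>.\<close>
  let ?d = "max c 1"
  have "x \<le> ?d *\<^sub>R x" using scaleR_right_mono[of 1 ?d x] nonneg by simp
  then have "inf x (c *\<^sub>R y) \<le> inf (?d *\<^sub>R x) (?d *\<^sub>R y)"
    using nonneg by (intro inf_mono scaleR_right_mono) auto
  also have "\<dots> = 0" using assms(1) by (simp flip: scaleR_inf_pos)
  finally show "inf x (c *\<^sub>R y) \<le> 0" .
  show "0 \<le> inf x (c *\<^sub>R y)" using nonneg assms(2) by (simp add: scaleR_nonneg_nonneg)
qed

text \<open>Shifting the index by one shows that \<open>s - y\<close> is still an upper bound of the
  multiples when \<open>s\<close> is their supremum.\<close>

lemma dedekind_complete_archimedean: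
  fixes y b :: "'a::riesz_space"
  assumes "dedekind_complete (UNIV :: 'a set)" "\<And>n::nat. real n *\<^sub>R y \<le> b"
  shows "y \<le> 0"
proof -
  obtain s where s: "isLub UNIV (range (\<lambda>n::nat. real n *\<^sub>R y)) s"
    using dedekind_complete_UNIV_isLub[OF assms(1), of "range (\<lambda>n::nat. real n *\<^sub>R y)" b] assms(2) by auto
  have "real n *\<^sub>R y \<le> s - y" for n :: nat
  proof -
    have "real (Suc n) *\<^sub>R y \<le> s" using s unfolding isLub_UNIV_iff by blast
    then show ?thesis by (simp add: scaleR_left_distrib le_diff_eq add.commute)
  qed
  then have "s \<le> s - y" using s unfolding isLub_UNIV_iff by blast
  then show ?thesis by simp
qed

text \<open>Transfers an infimum computed in \<open>A\<close> to the ambient space: a nonzero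
  positive part of \<open>l\<close> would dominate some \<open>v > 0\<close> in \<open>A\<close>,
  and this \<open>v\<close> would be a lower bound of \<open>Y\<close> inside
  \<open>A\<close>.\<close>

lemma order_dense_lower_bound_le_0:
  fixes l :: "'a::riesz_space"
  assumes "order_dense_in A UNIV" and Y: "isGlb A Y 0" and l: "\<And>y. y \<in> Y \<Longrightarrow> l \<le> y"
  shows "l \<le> 0"
proof -
  have "\<not> 0 < sup l 0"
  proof
    assume "0 < sup l 0"
    then obtain v where v: "v \<in> A" "0 < v" "v \<le> sup l 0"
      using assms(1) unfolding order_dense_in_def by blast
    have "v \<le> y" if "y \<in> Y" for y
    proof -
      have "0 \<le> y" using Y that by (auto simp: isGlb_def greatestP_def isLb_def setge_def)
      then show ?thesis using v(3) l[OF that] by (meson le_supI order_trans)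
    qed
    then have "v \<le> 0"
      using Y v(1) by (auto simp: isGlb_def greatestP_def isLb_def setge_def setle_def)
    then show False using v(2) by simp
  qed
  then have "sup l 0 = 0" by (metis sup_ge2 order_le_less)
  then show ?thesis by (metis sup_ge1)
qed

text \<open>Extracts preservation of directed suprema from continuity along filters. For an upper
  bound \<open>w\<close> of the image, \<open>f x - w\<close> lies below every element of the
  dominating set in \<open>B\<close>, and density of \<open>B\<close> makes it nonpositive.\<close>

lemma order_continuous_on_isLub:
  fixes f :: "'a::riesz_space \<Rightarrow> 'b::riesz_space"
  assumes A: "riesz_subspace A" and B: "riesz_subspace B" "order_dense_in B UNIV"
    and cont: "order_continuous_on A B f" and im: "f ` A \<subseteq> B"
    and mono: "\<And>x y. x \<in> A \<Longrightarrow> y \<in> A \<Longrightarrow> x \<le> y \<Longrightarrow> f x \<le> f y"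
    and X: "X \<subseteq> A" "up_directed X" and x: "x \<in> A" "isLub UNIV X x"
  shows "isLub UNIV (f ` X) (f x)"
proof -
  \<comment> \<open>The filter of tails of \<open>X\<close>, regarded as a net indexed by itself;
    the elements \<open>x - a\<close> with \<open>a\<close> in \<open>X\<close> dominate its
    distance to \<open>x\<close>.\<close>
  define F where "F = (INF a\<in>X. principal {b\<in>X. a \<le> b})"
  have ev: "eventually P F \<longleftrightarrow> (\<exists>a\<in>X. \<forall>b\<in>X. a \<le> b \<longrightarrow> P b)" for P
    unfolding F_def
  proof (subst eventually_INF_base)
    fix a b assume "a \<in> X" "b \<in> X"
    then obtain c where "c \<in> X" "a \<le> c" "b \<le> c" using X(2) unfolding up_directed_def by blast
    then show "\<exists>c\<in>X. principal {b \<in> X. c \<le> b} \<le> inf (principal {b \<in> X. a \<le> b}) (principal {c \<in> X. b \<le> c})"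
      by (intro bexI[of _ c]) (auto intro: order_trans)
  qed (use X(2) in \<open>auto simp: up_directed_def eventually_principal\<close>)
  have le: "a \<le> x" if "a \<in> X" for a using x(2) that by (auto simp: isLub_UNIV_iff)
  have "order_converges A F x"
    unfolding order_converges_def
  proof (intro conjI exI[of _ "(\<lambda>a. x - a) ` X"] ballI)
    show "(\<lambda>a. x - a) ` X \<subseteq> A"
      using A X(1) x(1) by (auto simp: riesz_subspace_def intro: subspace_diff)
    show "down_directed ((\<lambda>a. x - a) ` X)"
      using X(2) unfolding down_directed_def up_directed_def by (fastforce intro: diff_left_mono)
    have "l \<le> 0" if l: "\<forall>a\<in>X. l \<le> x - a" for l
    proof -
      have "x \<le> x - l"
        using x(2) l unfolding isLub_UNIV_iff by (metis le_diff_eq add.commute)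
      then show ?thesis by simp
    qed
    moreover have "0 \<in> A" using A by (simp add: riesz_subspace_def subspace_0)
    ultimately show "isGlb A ((\<lambda>a. x - a) ` X) 0"
      using le by (auto simp: isGlb_def greatestP_def isLb_def setge_def setle_def)
    fix y assume "y \<in> (\<lambda>a. x - a) ` X"
    then obtain a where a: "a \<in> X" "y = x - a" by auto
    have "\<bar>b - x\<bar> \<le> y" if "b \<in> X" "a \<le> b" for b
      using le[OF that(1)] a that
      by (metis abs_minus_commute abs_of_nonneg diff_ge_0_iff_ge diff_left_mono)
    then show "eventually (\<lambda>z. z \<in> A \<and> \<bar>z - x\<bar> \<le> y) F"
      unfolding ev using a X(1) by blast
  qed (fact x)
  then have "order_converges B (filtermap f F) (f x)"
    using cont by (auto simp: order_continuous_on_def)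
  then obtain Y where Y: "Y \<subseteq> B" "isGlb B Y 0"
      and Yev: "\<And>y. y \<in> Y \<Longrightarrow> eventually (\<lambda>z. f z \<in> B \<and> \<bar>f z - f x\<bar> \<le> y) F"
    by (auto simp: order_converges_def eventually_filtermap)
  show ?thesis
    unfolding isLub_UNIV_iff
  proof (intro conjI allI impI ballI)
    fix w assume w: "\<forall>z\<in>f ` X. z \<le> w"
    have lower: "f x - w \<le> y" if y: "y \<in> Y" for y
    proof -
      obtain a where a: "a \<in> X" "\<bar>f a - f x\<bar> \<le> y" using Yev[OF y] unfolding ev by blast
      have "f x - w \<le> f x - f a" using w a by (simp add: diff_left_mono)
      also have "\<dots> \<le> y" using a(2) by (metis abs_ge_self abs_minus_commute order_trans)
      finally show ?thesis .
    qed
    then have "f x - w \<le> 0" by (rule order_dense_lower_bound_le_0[OF B(2) Y(2)])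
    then show "f x \<le> w" by simp
  qed (use X le mono x(1) in auto)
qed

section \<open>Order dense ideals of the universal completion\<close>

locale riesz_completion =
  fixes E :: "'a::riesz_space set"
  assumes E: "riesz_subspace E" "dedekind_complete E"
    and compl: "ambient_is_universal_completion E"
begin

lemma dedekind: "dedekind_complete (UNIV :: 'a set)"
  and lateral: "laterally_complete (UNIV :: 'a set)"
  and dense: "order_dense_in E UNIV"
  using compl by (auto simp: ambient_is_universal_completion_def universally_complete_def)

lemmas E_closed = riesz_subspaceD[OF E(1)]

definition below :: "'a \<Rightarrow> 'a set" where
  "below x = {y \<in> E. 0 \<le> y \<and> y \<le> x}"

lemma below_up_directed: "0 \<le> x \<Longrightarrow> up_directed (below x)"
  unfolding up_directed_def
proof (intro conjI ballI)
  fix p q assume "p \<in> below x" "q \<in> below x"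
  then show "\<exists>z\<in>below x. p \<le> z \<and> q \<le> z"
    by (intro bexI[of _ "sup p q"]) (auto simp: below_def intro: E_closed le_supI1)
next
  assume "0 \<le> x"
  then have "0 \<in> below x" by (simp add: below_def E_closed)
  then show "below x \<noteq> {}" by blast
qed

text \<open>If \<open>w\<close> bounds \<open>below u\<close> but not \<open>u\<close>, density
  yields some \<open>y > 0\<close> in \<open>E\<close> under the gap \<open>u - inf u w\<close>, and
  every multiple of \<open>y\<close> would fit below \<open>u\<close>.\<close>

lemma isLub_below:
  assumes "0 \<le> u"
  shows "isLub UNIV (below u) u"
  unfolding isLub_UNIV_iff
proof (intro conjI allI impI ballI)
  fix w assume w: "\<forall>x\<in>below u. x \<le> w"
  have "\<not> 0 < u - inf u w"
  proof
    assume "0 < u - inf u w"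
    then obtain y where y: "y \<in> E" "0 < y" "y \<le> u - inf u w"
      using dense unfolding order_dense_in_def by blast
    \<comment> \<open>A multiple in \<open>below u\<close> is also at most \<open>w\<close>, hence
      at most \<open>inf u w\<close>; the gap then leaves room for one more
      \<open>y\<close>.\<close>
    have "real n *\<^sub>R y \<in> below u" for n
    proof (induction n)
      case 0
      then show ?case using assms by (simp add: below_def E_closed)
    next
      case (Suc n)
      then have "real n *\<^sub>R y \<le> inf u w" using w by (auto simp: below_def)
      then have "real n *\<^sub>R y + y \<le> inf u w + (u - inf u w)" using y(3) by (rule add_mono)
      then have "real n *\<^sub>R y + y \<le> u" by (simp only: add_diff_cancel_left' diff_add_cancel add.commute[of "inf u w"])
      then show ?case using y Suc
        by (auto simp: below_def scaleR_left_distrib E_closed add.commute intro!: add_nonneg_nonneg)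
    qed
    then have "y \<le> 0"
      by (intro dedekind_complete_archimedean[OF dedekind, of y u]) (auto simp: below_def)
    then show False using y(2) by simp
  qed
  then have "inf u w = u" by (metis inf_le1 diff_gt_0_iff_gt order_le_less)
  then show "u \<le> w" by (metis inf_le2)
qed (auto simp: below_def)

text \<open>Let \<open>s\<close> be the supremum of \<open>below u\<close> computed in
  \<open>E\<close>. If it exceeded \<open>u\<close>, some \<open>y > 0\<close> of \<open>E\<close>
  would fit under \<open>s - u\<close>, and \<open>s - y\<close> would be a smaller upper bound in
  \<open>E\<close>. So \<open>u = s\<close>.\<close>

lemma E_ideal:
  assumes "0 \<le> u" "u \<le> x" "x \<in> E"
  shows "u \<in> E"
proof -
  have "below u \<subseteq> E" "below u \<noteq> {}" "isUb E (below u) x"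
    using assms by (auto simp: below_def isUb_def setle_def intro!: exI[of _ 0] E_closed)
  then obtain s where s: "isLub E (below u) s"
    using E(2) unfolding dedekind_complete_def by blast
  then have sE: "s \<in> E" and ub: "\<forall>y\<in>below u. y \<le> s"
    by (auto simp: isLub_def leastP_def isUb_def setle_def)
  have "u \<le> s" using isLub_below[OF assms(1)] ub by (auto simp: isLub_UNIV_iff)
  have "\<not> 0 < s - u"
  proof
    assume "0 < s - u"
    then obtain y where y: "y \<in> E" "0 < y" "y \<le> s - u"
      using dense unfolding order_dense_in_def by blast
    have "z \<le> s - y" if "z \<in> below u" for z
    proof -
      have "z \<le> u" using that by (simp add: below_def)
      also have "u \<le> s - y" using y(3) by (simp add: le_diff_eq add.commute)
      finally show ?thesis .
    qed
    then have "s \<le> s - y"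
      using s y sE by (auto simp: isLub_def leastP_def isUb_def setle_def setge_def E_closed)
    then show False using y(2) by simp
  qed
  then show ?thesis using \<open>u \<le> s\<close> sE by (metis diff_gt_0_iff_gt order_le_less)
qed

lemma below_add:
  assumes "0 \<le> x" "0 \<le> y"
  shows "below (x + y) = {p + q |p q. p \<in> below x \<and> q \<in> below y}"
proof (intro equalityI subsetI)
  fix p assume p: "p \<in> below (x + y)"
  then have pE: "p \<in> E" "0 \<le> p" and le: "p \<le> x + y" by (auto simp: below_def)
  have nonneg: "0 \<le> inf p x" using pE(2) assms(1) by (rule inf_greatest)
  \<comment> \<open>Closure under \<open>inf\<close> does not suffice, since \<open>x\<close> may
    lie outside \<open>E\<close>; the ideal property does.\<close>
  have inE: "inf p x \<in> E" using nonneg inf_le1 pE(1) by (rule E_ideal)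
  have "p - y \<le> inf p x" using le assms(2) by (simp add: diff_le_eq)
  then have "p - inf p x \<le> y" by (metis diff_le_eq add.commute)
  moreover have "0 \<le> p - inf p x" by (simp only: diff_ge_0_iff_ge inf_le1)
  moreover have "p - inf p x \<in> E" using pE(1) inE by (rule E_closed)
  ultimately have "p - inf p x \<in> below y" unfolding below_def by blast
  moreover have "inf p x \<in> below x" using nonneg inE by (simp add: below_def)
  moreover have "p = inf p x + (p - inf p x)" by (metis add.commute diff_add_cancel)
  ultimately show "p \<in> {p + q |p q. p \<in> below x \<and> q \<in> below y}" by blast
qed (auto simp: below_def intro: E_closed add_mono)

lemma below_inf: "below (inf x y) = {inf p q |p q. p \<in> below x \<and> q \<in> below y}"
proof (intro equalityI subsetI)
  fix p assume "p \<in> below (inf x y)"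
  then show "p \<in> {inf p q |p q. p \<in> below x \<and> q \<in> below y}"
    by (intro CollectI exI[of _ p]) (auto simp: below_def)
qed (auto simp: below_def intro: E_closed le_infI1 le_infI2)

lemma below_scaleR:
  assumes "0 < c"
  shows "below (c *\<^sub>R x) = (*\<^sub>R) c ` below x"
proof (intro equalityI subsetI)
  fix p assume "p \<in> below (c *\<^sub>R x)"
  then have "p /\<^sub>R c \<in> below x" using assms
    by (auto simp: below_def E_closed pos_divideR_le_eq scaleR_nonneg_nonneg)
  then show "p \<in> (*\<^sub>R) c ` below x"
    using assms by (intro image_eqI[of _ _ "p /\<^sub>R c"]) auto
qed (use assms in \<open>auto simp: below_def E_closed scaleR_left_mono scaleR_nonneg_nonneg\<close>)

text \<open>
  Below every \<^term>\<open>u > 0\<close> there is then some \<^term>\<open>v > 0\<close> on whose band \<^term>\<open>X\<close> is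
  bounded. The suprema over a maximal disjoint family of such \<^term>\<open>v\<close> are glued by lateral
  completeness.
\<close>

lemma bounded_if_truncations_small:
  assumes X: "X \<noteq> {}" "\<And>x. x \<in> X \<Longrightarrow> 0 \<le> x"
    and small: "\<And>u. u \<in> E \<Longrightarrow> 0 < u \<Longrightarrow>
      \<exists>n::nat. \<not> isLub UNIV ((\<lambda>x. inf x (real n *\<^sub>R u)) ` X) (real n *\<^sub>R u)"
  shows "\<exists>b. \<forall>x\<in>X. x \<le> b"
proof -
  \<comment> \<open>The elements \<open>inf x (c *\<^sub>R v)\<close> for growing \<open>c\<close>
    exhaust the part of \<open>x\<close> in the band of \<open>v\<close>, so one bound
    \<open>b\<close> for all \<open>c\<close> and all \<open>x\<close> says that \<open>X\<close> is
    bounded on that band.\<close>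
  define V where "V = {v. 0 < v \<and> (\<exists>b. \<forall>x\<in>X. \<forall>c\<ge>0. inf x (c *\<^sub>R v) \<le> b)}"
  define \<A> where "\<A> = {M. M \<subseteq> V \<and> (\<forall>x\<in>M. \<forall>y\<in>M. x \<noteq> y \<longrightarrow> inf x y = 0)}"
  have "\<exists>M\<in>\<A>. \<forall>N\<in>\<A>. M \<subseteq> N \<longrightarrow> N = M"
  proof (rule subset_Zorn')
    fix C assume C: "subset.chain \<A> C"
    have "inf x y = 0" if "x \<in> M" "y \<in> N" "M \<in> C" "N \<in> C" "x \<noteq> y" for x y M N
    proof -
      have "M \<subseteq> N \<or> N \<subseteq> M" using C that by (auto simp: subset_chain_def)
      moreover have "M \<in> \<A>" "N \<in> \<A>" using C that by (auto simp: subset_chain_def)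
      ultimately show ?thesis using that unfolding \<A>_def by blast
    qed
    moreover have "\<Union>C \<subseteq> V" using C by (auto simp: subset_chain_def \<A>_def)
    ultimately show "\<Union>C \<in> \<A>" unfolding \<A>_def by blast
  qed
  then obtain M where M: "M \<in> \<A>" and maximal: "\<And>N. N \<in> \<A> \<Longrightarrow> M \<subseteq> N \<Longrightarrow> N = M" by blast
  define Q where "Q v = {inf x (c *\<^sub>R v) |x c. x \<in> X \<and> 0 \<le> c}" for v
  have "\<exists>s. isLub UNIV (Q v) s" if v: "v \<in> M" for v
  proof -
    obtain b where "\<forall>x\<in>X. \<forall>c\<ge>0. inf x (c *\<^sub>R v) \<le> b"
      using M v unfolding \<A>_def V_def by blast
    moreover have "Q v \<noteq> {}" using X(1) unfolding Q_def by fastforce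
    ultimately show ?thesis
      by (intro dedekind_complete_UNIV_isLub[OF dedekind, of _ b]) (auto simp: Q_def)
  qed
  then obtain \<beta> where \<beta>: "\<And>v. v \<in> M \<Longrightarrow> isLub UNIV (Q v) (\<beta> v)" by metis
  have Q_le: "inf x (c *\<^sub>R v) \<le> \<beta> v" if "v \<in> M" "x \<in> X" "0 \<le> c" for v x c
    using \<beta>[OF that(1)] that unfolding isLub_UNIV_iff Q_def by blast
  have \<beta>_nonneg: "0 \<le> \<beta> v" if v: "v \<in> M" for v
  proof -
    obtain x where "x \<in> X" using X(1) by blast
    then show ?thesis using Q_le[OF v, of x 0] X(2) by (simp add: inf_absorb2)
  qed
  have disj: "inf (\<beta> v) (\<beta> w) = 0" if "v \<in> M" "w \<in> M" "v \<noteq> w" for v w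
  proof (rule antisym)
    have vw: "inf v w = 0" using M that by (auto simp: \<A>_def)
    have "inf p q \<le> 0" if "p \<in> Q v" "q \<in> Q w" for p q
    proof -
      obtain c d where cd: "0 \<le> c" "0 \<le> d" "p \<le> c *\<^sub>R v" "q \<le> d *\<^sub>R w"
        using \<open>p \<in> Q v\<close> \<open>q \<in> Q w\<close> unfolding Q_def by (auto intro: inf_le2)
      have "inf (c *\<^sub>R v) (d *\<^sub>R w) = 0"
        using inf_scaleR_eq_0[OF _ cd(2)] inf_scaleR_eq_0[OF _ cd(1)] vw by (metis inf.commute)
      then show ?thesis using cd(3,4) by (metis inf_mono)
    qed
    then show "inf (\<beta> v) (\<beta> w) \<le> 0"
      using inf_isLub_isLub[OF \<beta>[OF that(1)] \<beta>[OF that(2)]] unfolding isLub_UNIV_iff by blast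
  qed (use that \<beta>_nonneg in auto)
  \<comment> \<open>The maximal family \<open>M\<close> may be empty, while lateral completeness
    asks for a nonempty set; adding 0 preserves disjointness.\<close>
  have "\<forall>x\<in>insert 0 (\<beta> ` M). \<forall>y\<in>insert 0 (\<beta> ` M). x \<noteq> y \<longrightarrow> inf x y = 0"
    using disj \<beta>_nonneg by (auto simp: inf_absorb1 inf_absorb2)
  moreover have "\<forall>x\<in>insert 0 (\<beta> ` M). 0 \<le> x" using \<beta>_nonneg by auto
  ultimately have "\<exists>B. isLub UNIV (insert 0 (\<beta> ` M)) B"
    using lateral unfolding laterally_complete_def by (metis insert_not_empty subset_UNIV)
  then obtain B where B: "isLub UNIV (insert 0 (\<beta> ` M)) B" ..
  have \<beta>_le: "\<beta> v \<le> B" if "v \<in> M" for v using B that by (auto simp: isLub_UNIV_iff)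
  have "x \<le> B" if x: "x \<in> X" for x
  proof (rule ccontr)
    assume "\<not> x \<le> B"
    \<comment> \<open>The excess of \<open>x\<close> over \<open>B\<close>. It is disjoint from
      \<open>M\<close>, so it leads to a new member of \<open>V\<close> disjoint from
      \<open>M\<close>, against maximality.\<close>
    define z where "z = sup (x - B) 0"
    have "z \<noteq> 0" using \<open>\<not> x \<le> B\<close> unfolding z_def by (metis sup_ge1 diff_le_0_iff_le)
    then have "0 < z" unfolding z_def by (metis sup_ge2 order_le_less)
    have split: "inf x B + z = x"
    proof -
      have "z = sup x B - B" unfolding z_def
        by (metis add_sup_distrib_right diff_conv_add_uminus add.right_inverse)
      then show ?thesis using add_eq_inf_sup[of x B]
        by (metis add.commute add_diff_cancel_right' add_diff_eq)
    qed
    have z_disj: "inf z v = 0" if v: "v \<in> M" for v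
    proof (rule antisym)
      have "0 < v" using M v by (auto simp: \<A>_def V_def)
      then show "0 \<le> inf z v" using \<open>0 < z\<close> by (simp add: less_imp_le)
      \<comment> \<open>By induction a multiple of \<open>inf z v\<close> is at most
        \<open>\<beta> v\<close>, hence at most \<open>inf x B\<close>; adding one more copy, which
        is below \<open>z\<close>, stays below \<open>inf x B + z = x\<close>. The Archimedean
        property then removes \<open>inf z v\<close>.\<close>
      have "real n *\<^sub>R inf z v \<le> inf x (real n *\<^sub>R v)" for n
      proof (induction n)
        case 0
        then show ?case using X(2)[OF x] by simp
      next
        case (Suc n)
        have "real n *\<^sub>R inf z v \<le> inf x B"
          using Suc Q_le[OF v x, of "real n"] \<beta>_le[OF v] by (meson le_inf_iff of_nat_0_le_iff order_trans)
        then have "real n *\<^sub>R inf z v + inf z v \<le> inf x B + z" by (intro add_mono) auto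
        then have "real (Suc n) *\<^sub>R inf z v \<le> x"
          unfolding split by (simp add: scaleR_left_distrib add.commute)
        moreover have "real (Suc n) *\<^sub>R inf z v \<le> real (Suc n) *\<^sub>R v"
          by (intro scaleR_left_mono) auto
        ultimately show ?case by simp
      qed
      then have "real n *\<^sub>R inf z v \<le> x" for n by (meson le_inf_iff)
      then show "inf z v \<le> 0" by (intro dedekind_complete_archimedean[OF dedekind])
    qed
    obtain u where u: "u \<in> E" "0 < u" "u \<le> z"
      using dense \<open>0 < z\<close> unfolding order_dense_in_def by blast
    then obtain n where n: "\<not> isLub UNIV ((\<lambda>x. inf x (real n *\<^sub>R u)) ` X) (real n *\<^sub>R u)"
      using small by blast
    have "\<exists>g. isLub UNIV ((\<lambda>x. inf x (real n *\<^sub>R u)) ` X) g"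
      using X(1) by (intro dedekind_complete_UNIV_isLub[OF dedekind, of _ "real n *\<^sub>R u"]) auto
    then obtain g where g: "isLub UNIV ((\<lambda>x. inf x (real n *\<^sub>R u)) ` X) g" ..
    have g_le: "g \<le> real n *\<^sub>R u" using g by (auto simp: isLub_UNIV_iff)
    have nu: "0 \<le> real n *\<^sub>R u" using u by (simp add: scaleR_nonneg_nonneg)
    have g_nonneg: "0 \<le> g"
    proof -
      have "0 \<le> inf x (real n *\<^sub>R u)" using X(2)[OF x] nu by simp
      also have "\<dots> \<le> g" using g x by (auto simp: isLub_UNIV_iff)
      finally show ?thesis .
    qed
    \<comment> \<open>The shortfall of the truncations at \<open>n\<close> times \<open>u\<close>.
      On its band they stay strictly under the cutoff, so there the cutoff is not felt and
      \<open>X\<close> itself is bounded by \<open>g\<close>.\<close>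
    define v where "v = real n *\<^sub>R u - g"
    have "0 < v" using g n g_le unfolding v_def by (metis diff_gt_0_iff_gt order_le_less)
    have "inf y (c *\<^sub>R v) \<le> g" if y: "y \<in> X" "0 \<le> c" for y c
    proof -
      let ?p = "sup (y - g) 0"
      have "inf y (real n *\<^sub>R u) \<le> g" using g y by (auto simp: isLub_UNIV_iff)
      \<comment> \<open>Subtracting \<open>g\<close> from both arguments of
        \<open>inf y (real n *\<^sub>R u)\<close> turns the second one into
        \<open>v\<close>.\<close>
      then have "inf (y - g) v \<le> 0"
        unfolding v_def
        by (metis add_inf_distrib_right diff_conv_add_uminus diff_le_0_iff_le)
      then have "inf ?p v = 0"
      proof -
        have "inf ?p v = sup (inf (y - g) v) (inf 0 v)" by (rule inf_sup_distrib_riesz)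
        then show ?thesis using \<open>inf (y - g) v \<le> 0\<close> \<open>0 < v\<close>
          by (simp add: inf_absorb1 sup_absorb2)
      qed
      then have "inf ?p (c *\<^sub>R v) = 0" using y(2) by (rule inf_scaleR_eq_0)
      have "y - g \<le> ?p" by simp
      then have "y \<le> g + ?p" by (metis diff_le_eq add.commute)
      then have "inf y (c *\<^sub>R v) \<le> inf (g + ?p) (g + c *\<^sub>R v)"
        using g_nonneg by (intro inf_mono) auto
      also have "\<dots> = g" using \<open>inf ?p (c *\<^sub>R v) = 0\<close> by (simp flip: add_inf_distrib_left)
      finally show ?thesis .
    qed
    then have "v \<in> V" using \<open>0 < v\<close> by (auto simp: V_def)
    have v_disj: "inf v w = 0" if w: "w \<in> M" for w
    proof (rule antisym)
      have "0 < w" using M w by (auto simp: \<A>_def V_def)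
      then show "0 \<le> inf v w" using \<open>0 < v\<close> by (simp add: less_imp_le)
      have "v \<le> real n *\<^sub>R z"
      proof -
        have "v \<le> real n *\<^sub>R u" using g_nonneg by (simp add: v_def)
        also have "\<dots> \<le> real n *\<^sub>R z" using u by (intro scaleR_left_mono) auto
        finally show ?thesis .
      qed
      then have "inf v w \<le> inf w (real n *\<^sub>R z)" by (metis inf.commute inf_mono order_refl)
      also have "\<dots> = 0" using z_disj[OF w] by (intro inf_scaleR_eq_0) (auto simp: inf.commute)
      finally show "inf v w \<le> 0" .
    qed
    then have "insert v M \<in> \<A>"
      using M \<open>v \<in> V\<close> by (auto simp: \<A>_def inf.commute)
    then have "v \<in> M" using maximal by blast
    \<comment> \<open>Membership in \<open>M\<close> makes \<open>v\<close> disjoint from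
      itself.\<close>
    then have "v = 0" using v_disj by force
    then show False using \<open>0 < v\<close> by simp
  qed
  then show ?thesis by blast
qed

end

section \<open>Positive operators and Riesz homomorphisms\<close>

lemma linear_map_onD:
  assumes "linear_map_on A B f" "riesz_subspace A"
  shows "x \<in> A \<Longrightarrow> f x \<in> B" "x \<in> A \<Longrightarrow> y \<in> A \<Longrightarrow> f (x + y) = f x + f y"
    "x \<in> A \<Longrightarrow> f (c *\<^sub>R x) = c *\<^sub>R f x" "x \<in> A \<Longrightarrow> f (- x) = - f x"
    "x \<in> A \<Longrightarrow> y \<in> A \<Longrightarrow> f (x - y) = f x - f y" "f 0 = 0"
proof -
  note A = riesz_subspaceD[OF assms(2)]
  show im: "x \<in> A \<Longrightarrow> f x \<in> B" for x using assms(1) by (auto simp: linear_map_on_def)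
  show add: "x \<in> A \<Longrightarrow> y \<in> A \<Longrightarrow> f (x + y) = f x + f y" for x y
    using assms(1) by (auto simp: linear_map_on_def)
  show scale: "x \<in> A \<Longrightarrow> f (c *\<^sub>R x) = c *\<^sub>R f x" for x c
    using assms(1) by (auto simp: linear_map_on_def)
  show neg: "x \<in> A \<Longrightarrow> f (- x) = - f x" for x using scale[of x "-1"] by simp
  show "x \<in> A \<Longrightarrow> y \<in> A \<Longrightarrow> f (x - y) = f x - f y" for x y
    using add[of x "- y"] neg[of y] A(5) by simp
  show "f 0 = 0" using scale[of 0 0] A(1) by simp
qed

lemma riesz_hom_onD:
  assumes "riesz_hom_on A B f" "riesz_subspace A" "x \<in> A" "y \<in> A"
  shows "f (sup x y) = sup (f x) (f y)" "f (inf x y) = inf (f x) (f y)"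
    "f \<bar>x\<bar> = \<bar>f x\<bar>" "x \<le> y \<Longrightarrow> f x \<le> f y"
proof -
  have lin: "linear_map_on A B f" using assms(1) by (simp add: riesz_hom_on_def)
  show sup: "f (sup x y) = sup (f x) (f y)"
    using assms by (simp add: riesz_hom_on_def)
  show inf: "f (inf x y) = inf (f x) (f y)"
    using assms by (simp add: riesz_hom_on_def)
  have "f (sup x (- x)) = sup (f x) (f (- x))"
    using assms riesz_subspaceD(5)[OF assms(2)] by (simp add: riesz_hom_on_def)
  then show "f \<bar>x\<bar> = \<bar>f x\<bar>"
    using linear_map_onD(4)[OF lin assms(2,3)] by (simp add: abs_lattice)
  show "x \<le> y \<Longrightarrow> f x \<le> f y" using inf by (metis inf_absorb1 inf_le2)
qed

lemma riesz_hom_order_continuousI: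
  fixes f :: "'a::riesz_space \<Rightarrow> 'a"
  assumes A: "riesz_subspace A" "order_dense_in A UNIV" and hom: "riesz_hom_on A A f"
    and Lub: "\<And>X x. X \<subseteq> A \<Longrightarrow> (\<forall>y\<in>X. 0 \<le> y) \<Longrightarrow> up_directed X \<Longrightarrow> x \<in> A \<Longrightarrow>
      isLub UNIV X x \<Longrightarrow> isLub UNIV (f ` X) (f x)"
  shows "order_continuous_on A A f"
  unfolding order_continuous_on_def
proof (intro allI impI)
  fix F x assume conv: "order_converges A F x"
  note closed = riesz_subspaceD[OF A(1)]
  have lin: "linear_map_on A A f" using hom by (simp add: riesz_hom_on_def)
  note f_lin = linear_map_onD[OF lin A(1)] and f_hom = riesz_hom_onD[OF hom A(1)]
  from conv obtain Y where x: "x \<in> A" and Y: "Y \<subseteq> A" "down_directed Y" "isGlb A Y 0"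
    and ev: "\<And>y. y \<in> Y \<Longrightarrow> eventually (\<lambda>z. z \<in> A \<and> \<bar>z - x\<bar> \<le> y) F"
    by (auto simp: order_converges_def)
  have Y_nonneg: "0 \<le> y" if "y \<in> Y" for y
    using Y(3) that by (auto simp: isGlb_def greatestP_def isLb_def setge_def)
  have "l \<le> 0" if l: "\<And>y. y \<in> Y \<Longrightarrow> l \<le> f y" for l
  proof -
    obtain y0 where y0: "y0 \<in> Y" using Y(2) by (auto simp: down_directed_def)
    \<comment> \<open>Reflecting \<open>Y\<close> at one of its elements turns decrease to 0 into
      increase to \<open>y0\<close>; only \<open>y <= y0\<close> are kept so that \<open>X\<close>
      stays positive, and directedness of \<open>Y\<close> shows that these suffice.\<close>
    define X where "X = {y0 - y |y. y \<in> Y \<and> y \<le> y0}"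
    have "isLub UNIV X y0"
      unfolding isLub_UNIV_iff
    proof (intro conjI allI impI ballI)
      fix w assume w: "\<forall>z\<in>X. z \<le> w"
      have "y0 - w \<le> y" if "y \<in> Y" for y
      proof -
        obtain y' where y': "y' \<in> Y" "y' \<le> y" "y' \<le> y0"
          using Y(2) y0 \<open>y \<in> Y\<close> unfolding down_directed_def by blast
        have "y0 - y' \<le> w" using w y' unfolding X_def by blast
        then have "y0 - w \<le> y'" by (metis add.commute diff_le_eq)
        then show ?thesis using y'(2) by (rule order_trans)
      qed
      then have "y0 - w \<le> 0" by (rule order_dense_lower_bound_le_0[OF A(2) Y(3)])
      then show "y0 \<le> w" by simp
    next
      fix z assume "z \<in> X"
      then obtain y where y: "y \<in> Y" "z = y0 - y" unfolding X_def by blast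
      show "z \<le> y0" using diff_left_mono[OF Y_nonneg[OF y(1)], of y0] unfolding y(2) diff_zero .
    qed
    moreover have "X \<subseteq> A" using Y(1) y0 closed(3) unfolding X_def by blast
    moreover have "up_directed X"
      unfolding up_directed_def
    proof (intro conjI ballI)
      show "X \<noteq> {}" using y0 unfolding X_def by blast
      fix p q assume "p \<in> X" "q \<in> X"
      then obtain y z where yz: "p = y0 - y" "q = y0 - z" "y \<in> Y" "z \<in> Y" "y \<le> y0" "z \<le> y0"
        unfolding X_def by blast
      then obtain t where "t \<in> Y" "t \<le> y" "t \<le> z" using Y(2) unfolding down_directed_def by blast
      then show "\<exists>r\<in>X. p \<le> r \<and> q \<le> r"
        using yz unfolding X_def
        by (intro bexI[of _ "y0 - t"]) (auto intro: diff_left_mono order_trans)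
    qed
    moreover have "\<forall>y\<in>X. 0 \<le> y" by (auto simp: X_def)
    ultimately have lub: "isLub UNIV (f ` X) (f y0)" using y0 Y(1) by (intro Lub) auto
    have "z \<le> f y0 - l" if z: "z \<in> f ` X" for z
    proof -
      obtain y where y: "y \<in> Y" "z = f (y0 - y)" using z unfolding X_def by blast
      then have "z = f y0 - f y" using f_lin(5) Y(1) y0 by auto
      then show ?thesis using l[OF y(1)] by (simp add: diff_left_mono)
    qed
    then have "f y0 \<le> f y0 - l" using lub unfolding isLub_UNIV_iff by blast
    then show ?thesis by simp
  qed
  moreover have "0 \<le> f y" if "y \<in> Y" for y
    using f_hom(4)[of 0 y] f_lin(6) closed(1) Y(1) Y_nonneg that by auto
  ultimately have "isGlb A (f ` Y) 0"
    using closed(1) by (auto simp: isGlb_def greatestP_def isLb_def setge_def setle_def)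
  moreover have "f ` Y \<subseteq> A" using f_lin(1) Y(1) by blast
  moreover have "down_directed (f ` Y)"
    unfolding down_directed_def
  proof (intro conjI ballI)
    show "f ` Y \<noteq> {}" using Y(2) by (auto simp: down_directed_def)
    fix p q assume "p \<in> f ` Y" "q \<in> f ` Y"
    then obtain y z where yz: "p = f y" "q = f z" "y \<in> Y" "z \<in> Y" by blast
    then obtain t where t: "t \<in> Y" "t \<le> y" "t \<le> z" using Y(2) unfolding down_directed_def by blast
    then have "f t \<le> f y" "f t \<le> f z" using yz Y(1) by (auto intro!: f_hom(4))
    then show "\<exists>r\<in>f ` Y. r \<le> p \<and> r \<le> q" using t(1) yz by blast
  qed
  moreover have "eventually (\<lambda>z. z \<in> A \<and> \<bar>z - f x\<bar> \<le> y) (filtermap f F)" if y: "y \<in> f ` Y" for y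
  proof -
    obtain v where v: "v \<in> Y" "y = f v" using y by blast
    have "f z \<in> A \<and> \<bar>f z - f x\<bar> \<le> y" if z: "z \<in> A \<and> \<bar>z - x\<bar> \<le> v" for z
    proof -
      have zx: "z - x \<in> A" using z x closed(3) by blast
      then have "\<bar>z - x\<bar> \<in> A" unfolding abs_lattice using closed(5,6) by blast
      then have "f \<bar>z - x\<bar> \<le> f v" using z v(1) Y(1) by (intro f_hom(4)) auto
      then show ?thesis using f_hom(3)[OF zx zx] f_lin(1,5) z x v(2) by auto
    qed
    then show ?thesis
      unfolding eventually_filtermap using ev[OF v(1)] by (auto elim: eventually_mono)
  qed
  ultimately show "order_converges A (filtermap f F) (f x)"
    unfolding order_converges_def using f_lin(1) x by blast
qed

lemma pprt_diff_pprt_minus: "pprt x - pprt (- x) = (x::'a::lattice_ab_group_add)"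
  using prts[of x] by (simp add: pprt_neg)

text \<open>Instantiated with \<open>T\<close> and with \<open>S\<close>, so that both extensions
  come from one construction.\<close>

locale positive_operator = riesz_completion +
  fixes f :: "'a \<Rightarrow> 'a"
  assumes linear: "linear_map_on E E f"
    and nonneg: "\<And>x. x \<in> E \<Longrightarrow> 0 \<le> x \<Longrightarrow> 0 \<le> f x"
    and continuous: "order_continuous_on E E f"
begin

section \<open>Extension of a positive operator to positive elements\<close>

lemmas f_lin = linear_map_onD[OF linear E(1)]

lemma f_mono: "x \<in> E \<Longrightarrow> y \<in> E \<Longrightarrow> x \<le> y \<Longrightarrow> f x \<le> f y"
  using nonneg[of "y - x"] f_lin(5)[of y x] by (simp add: E_closed)

lemma f_isLub:
  assumes "X \<subseteq> E" "up_directed X" "x \<in> E" "isLub UNIV X x"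
  shows "isLub UNIV (f ` X) (f x)"
  using order_continuous_on_isLub[OF E(1) E(1) dense continuous _ f_mono assms] f_lin(1) by blast

text \<open>Tests boundedness on the canonical net \<open>below x\<close> where
  \<open>natural_domain_pos\<close> asks for some approximating net;
  \<open>natural_domain_pos_eq\<close> shows that the two agree.\<close>

definition dom_pos :: "'a set" where
  "dom_pos = {x. 0 \<le> x \<and> (\<exists>b. \<forall>y\<in>below x. f y \<le> b)}"

definition ext :: "'a \<Rightarrow> 'a" where
  "ext x = (THE s. isLub UNIV (f ` below x) s)"

text \<open>Splitting into positive and negative part avoids a choice of decomposition; by
  \<open>ext_diff_eq\<close> every decomposition within \<open>dom_pos\<close> gives the same
  value.\<close>

definition ext_diff :: "'a \<Rightarrow> 'a" where
  "ext_diff x = ext (pprt x) - ext (pprt (- x))"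

lemma ext_eqI: "isLub UNIV (f ` below x) s \<Longrightarrow> ext x = s"
  unfolding ext_def by (auto intro: isLub_UNIV_unique)

lemma dom_pos_nonneg: "x \<in> dom_pos \<Longrightarrow> 0 \<le> x"
  by (simp add: dom_pos_def)

lemma isLub_ext:
  assumes "x \<in> dom_pos"
  shows "isLub UNIV (f ` below x) (ext x)"
proof -
  obtain b where b: "0 \<le> x" "\<forall>y\<in>below x. f y \<le> b" using assms by (auto simp: dom_pos_def)
  then have "0 \<in> below x" by (simp add: below_def E_closed)
  then have "\<exists>s. isLub UNIV (f ` below x) s"
    using b by (intro dedekind_complete_UNIV_isLub[OF dedekind, of _ b]) auto
  then show ?thesis using ext_eqI by blast
qed

lemma le_ext: "x \<in> dom_pos \<Longrightarrow> y \<in> below x \<Longrightarrow> f y \<le> ext x"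
  using isLub_ext unfolding isLub_UNIV_iff by blast

lemma ext_least: "x \<in> dom_pos \<Longrightarrow> (\<And>y. y \<in> below x \<Longrightarrow> f y \<le> b) \<Longrightarrow> ext x \<le> b"
  using isLub_ext unfolding isLub_UNIV_iff by blast

lemma ext_E:
  assumes "x \<in> E" "0 \<le> x"
  shows "x \<in> dom_pos" "ext x = f x"
proof -
  have *: "\<forall>y\<in>below x. f y \<le> f x" using assms by (auto simp: below_def f_mono)
  then show "x \<in> dom_pos" using assms by (auto simp: dom_pos_def)
  have "x \<in> below x" using assms by (simp add: below_def)
  then show "ext x = f x" using * by (intro ext_eqI) (auto simp: isLub_UNIV_iff)
qed

lemma below_mono: "u \<le> x \<Longrightarrow> below u \<subseteq> below x"
  by (auto simp: below_def)

lemma dom_pos_ideal: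
  assumes "x \<in> dom_pos" "0 \<le> u" "u \<le> x"
  shows "u \<in> dom_pos"
  using assms below_mono[OF assms(3)] unfolding dom_pos_def by blast

lemma ext_mono:
  assumes "x \<in> dom_pos" "0 \<le> u" "u \<le> x"
  shows "ext u \<le> ext x"
  using below_mono[OF assms(3)]
  by (intro ext_least dom_pos_ideal[OF assms]) (use assms(1) in \<open>auto intro: le_ext\<close>)

lemma ext_0: "ext 0 = 0"
  using ext_E(2)[of 0] f_lin(6) by (simp add: E_closed)

lemma ext_nonneg: "x \<in> dom_pos \<Longrightarrow> 0 \<le> ext x"
  using ext_mono[of x 0] dom_pos_nonneg by (simp add: ext_0)

lemma ext_add:
  assumes "x \<in> dom_pos" "y \<in> dom_pos"
  shows "x + y \<in> dom_pos" "ext (x + y) = ext x + ext y"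
proof -
  have *: "f ` below (x + y) = {p + q |p q. p \<in> f ` below x \<and> q \<in> f ` below y}"
  proof -
    have "f ` below (x + y) = {f (p + q) |p q. p \<in> below x \<and> q \<in> below y}"
      unfolding below_add[OF assms[THEN dom_pos_nonneg]] by blast
    also have "\<dots> = {f p + f q |p q. p \<in> below x \<and> q \<in> below y}"
      using f_lin(2) unfolding below_def by (metis (lifting) mem_Collect_eq)
    also have "\<dots> = {p + q |p q. p \<in> f ` below x \<and> q \<in> f ` below y}" by blast
    finally show ?thesis .
  qed
  have lub: "isLub UNIV (f ` below (x + y)) (ext x + ext y)"
    unfolding * by (intro add_isLub isLub_ext assms)
  then show "ext (x + y) = ext x + ext y" by (rule ext_eqI)
  show "x + y \<in> dom_pos"
    using lub assms[THEN dom_pos_nonneg] unfolding dom_pos_def isLub_UNIV_iff by auto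
qed

lemma ext_scaleR:
  assumes "x \<in> dom_pos" "0 \<le> c"
  shows "c *\<^sub>R x \<in> dom_pos" "ext (c *\<^sub>R x) = c *\<^sub>R ext x"
proof -
  have "c *\<^sub>R x \<in> dom_pos \<and> ext (c *\<^sub>R x) = c *\<^sub>R ext x"
  proof (cases "c = 0")
    case True
    then show ?thesis using ext_E(1)[of 0] by (simp add: ext_0 E_closed)
  next
    case False
    then have "0 < c" using assms(2) by simp
    have "f ` below (c *\<^sub>R x) = (*\<^sub>R) c ` f ` below x"
      unfolding below_scaleR[OF \<open>0 < c\<close>] image_image
      by (rule image_cong) (auto simp: below_def f_lin(3))
    then have lub: "isLub UNIV (f ` below (c *\<^sub>R x)) (c *\<^sub>R ext x)"
      using scaleR_isLub[OF isLub_ext[OF assms(1)] \<open>0 < c\<close>] by simp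
    then have "c *\<^sub>R x \<in> dom_pos"
      using dom_pos_nonneg[OF assms(1)] assms(2) unfolding dom_pos_def isLub_UNIV_iff
      by (auto simp: scaleR_nonneg_nonneg)
    then show ?thesis using ext_eqI[OF lub] by simp
  qed
  then show "c *\<^sub>R x \<in> dom_pos" "ext (c *\<^sub>R x) = c *\<^sub>R ext x" by auto
qed

text \<open>No single \<open>q\<close> in \<open>Z\<close> need dominate \<open>p\<close>, and
  \<open>Z\<close> may leave \<open>E\<close>. But the truncations \<open>inf q p\<close> lie in the
  ideal \<open>E\<close> and increase to \<open>p\<close>, so order continuity of \<open>f\<close>
  on \<open>E\<close> passes the bound to \<open>f p\<close>.\<close>

lemma f_le_of_directed:
  assumes Z: "up_directed Z" "\<And>q. q \<in> Z \<Longrightarrow> 0 \<le> q" "isLub UNIV Z z"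
    and w: "\<And>q r. q \<in> Z \<Longrightarrow> r \<in> below q \<Longrightarrow> f r \<le> w"
    and p: "p \<in> below z"
  shows "f p \<le> w"
proof -
  have pE: "p \<in> E" "0 \<le> p" "p \<le> z" using p by (auto simp: below_def)
  let ?X = "(\<lambda>q. inf q p) ` Z"
  have inE: "inf q p \<in> E" if "q \<in> Z" for q
    using inf_greatest[OF Z(2)[OF that] pE(2)] inf_le2 pE(1) by (rule E_ideal)
  have "isLub UNIV ?X p" using inf_isLub[OF Z(3), of p] pE(3) by (simp add: inf_absorb2)
  moreover have "up_directed ?X"
    unfolding up_directed_def
  proof (intro conjI ballI)
    show "?X \<noteq> {}" using Z(1) by (auto simp: up_directed_def)
    fix a b assume "a \<in> ?X" "b \<in> ?X"
    then obtain q r where qr: "q \<in> Z" "r \<in> Z" "a = inf q p" "b = inf r p" by blast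
    then obtain t where "t \<in> Z" "q \<le> t" "r \<le> t" using Z(1) unfolding up_directed_def by blast
    then show "\<exists>c\<in>?X. a \<le> c \<and> b \<le> c"
      unfolding qr by (intro bexI[of _ "inf t p"]) (auto intro: le_infI1)
  qed
  ultimately have "isLub UNIV (f ` ?X) (f p)" using inE pE(1) by (intro f_isLub) auto
  moreover have "f (inf q p) \<le> w" if "q \<in> Z" for q
    using w[OF that] inE[OF that] Z(2)[OF that] pE by (simp add: below_def)
  ultimately show ?thesis unfolding isLub_UNIV_iff by blast
qed

lemma isLub_ext_directed:
  assumes Z: "Z \<subseteq> dom_pos" "up_directed Z" "isLub UNIV Z z" and z: "z \<in> dom_pos"
  shows "isLub UNIV (ext ` Z) (ext z)"
  unfolding isLub_UNIV_iff
proof (intro conjI allI impI ballI)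
  fix y assume "y \<in> ext ` Z"
  then obtain q where "q \<in> Z" "y = ext q" by blast
  then show "y \<le> ext z"
    using Z(1,3) z dom_pos_nonneg unfolding isLub_UNIV_iff by (auto intro!: ext_mono)
next
  fix w assume w: "\<forall>y\<in>ext ` Z. y \<le> w"
  have "f p \<le> w" if "p \<in> below z" for p
  proof (rule f_le_of_directed[OF Z(2) _ Z(3) _ that])
    fix q r assume "q \<in> Z" "r \<in> below q"
    then have "f r \<le> ext q" using Z(1) by (intro le_ext) auto
    also have "ext q \<le> w" using w \<open>q \<in> Z\<close> by blast
    finally show "f r \<le> w" .
  qed (use Z(1) dom_pos_nonneg in auto)
  then show "ext z \<le> w" by (rule ext_least[OF z])
qed

text \<open>Independence of the approximating net, hence well-definedness of
  \<open>extend_pos\<close>: \<open>f\<close> X\<open>and\<close>f \<open>below x\<close> have the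
  same upper bounds.\<close>

lemma isLub_approximating:
  assumes "X \<subseteq> E" "\<And>y. y \<in> X \<Longrightarrow> 0 \<le> y" "up_directed X" "isLub UNIV X x"
  shows "isLub UNIV (f ` X) s \<longleftrightarrow> isLub UNIV (f ` below x) s"
proof -
  have "X \<subseteq> below x" using assms unfolding isLub_UNIV_iff below_def by blast
  moreover have "f p \<le> b" if b: "\<forall>y\<in>X. f y \<le> b" and p: "p \<in> below x" for b p
  proof (rule f_le_of_directed[OF assms(3,2,4) _ p])
    fix q r assume "q \<in> X" "r \<in> below q"
    then have "f r \<le> f q" using assms(1) by (intro f_mono) (auto simp: below_def)
    then show "f r \<le> b" using b \<open>q \<in> X\<close> by (blast intro: order_trans)
  qed
  ultimately have "(\<forall>y\<in>X. f y \<le> b) \<longleftrightarrow> (\<forall>y\<in>below x. f y \<le> b)" for b by blast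
  then show ?thesis unfolding isLub_UNIV_iff ball_simps by simp
qed

lemma natural_domain_pos_eq: "natural_domain_pos E f = dom_pos"
proof (intro equalityI subsetI)
  fix x assume "x \<in> natural_domain_pos E f"
  then obtain X a b where x: "0 \<le> x" and X: "X \<subseteq> E" "\<forall>y\<in>X. 0 \<le> y" "up_directed X" "isLub UNIV X x"
    and b: "f ` X \<subseteq> {a..b}"
    by (auto simp: natural_domain_pos_def approximating_def)
  have "f p \<le> b" if p: "p \<in> below x" for p
  proof (rule f_le_of_directed[OF X(3) _ X(4) _ p])
    fix q r assume "q \<in> X" "r \<in> below q"
    then have "f r \<le> f q" using X(1) by (intro f_mono) (auto simp: below_def)
    also have "f q \<le> b" using b \<open>q \<in> X\<close> by auto
    finally show "f r \<le> b" .
  qed (use X in auto)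
  then show "x \<in> dom_pos" using x by (auto simp: dom_pos_def)
next
  fix x assume x: "x \<in> dom_pos"
  then have "f ` below x \<subseteq> {0..ext x}" using le_ext nonneg by (auto simp: below_def)
  then have "approximating E f (below x) x"
    using isLub_below below_up_directed dom_pos_nonneg[OF x]
    unfolding approximating_def below_def by blast
  then show "x \<in> natural_domain_pos E f"
    using dom_pos_nonneg[OF x] by (auto simp: natural_domain_pos_def)
qed

lemma extend_pos_eq:
  assumes x: "x \<in> dom_pos"
  shows "extend_pos E f x = ext x"
  unfolding extend_pos_def
proof (rule the_equality)
  have "x \<in> natural_domain_pos E f" using x by (simp add: natural_domain_pos_eq)
  then obtain X where X: "approximating E f X x" by (auto simp: natural_domain_pos_def)
  then have "isLub UNIV (f ` X) (ext x)"
    using isLub_approximating[of X x "ext x"] isLub_ext[OF x] by (simp add: approximating_def)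
  then show "\<exists>X. approximating E f X x \<and> isLub UNIV (f ` X) (ext x)" using X by blast
next
  fix s assume "\<exists>X. approximating E f X x \<and> isLub UNIV (f ` X) s"
  then obtain X where X: "approximating E f X x" "isLub UNIV (f ` X) s" by blast
  then have "isLub UNIV (f ` below x) s"
    using isLub_approximating[of X x s] by (simp add: approximating_def)
  then show "s = ext x" using ext_eqI by blast
qed

section \<open>Differences of positive elements and the natural domain\<close>

lemma dom_pos_pprt:
  assumes "u \<in> dom_pos" "v \<in> dom_pos"
  shows "pprt (u - v) \<in> dom_pos"
proof (rule dom_pos_ideal[OF assms(1)])
  show "pprt (u - v) \<le> u"
    using assms[THEN dom_pos_nonneg] by (simp add: pprt_def)
qed simp

text \<open>Moving the subtracted terms across the equation leaves two equal sums in
  \<open>dom_pos\<close>, to which additivity of \<open>ext\<close> applies.\<close>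

lemma ext_diff_eq:
  assumes "u \<in> dom_pos" "v \<in> dom_pos"
  shows "ext_diff (u - v) = ext u - ext v"
proof -
  let ?p = "pprt (u - v)" and ?n = "pprt (- (u - v))"
  have dom: "?p \<in> dom_pos" "?n \<in> dom_pos"
    using dom_pos_pprt[OF assms] dom_pos_pprt[OF assms(2,1)] by simp_all
  have "?p - ?n = u - v" by (rule pprt_diff_pprt_minus)
  then have "?p + v = u + ?n" by (metis add.commute diff_add_eq diff_eq_eq)
  then have "ext ?p + ext v = ext u + ext ?n" using ext_add(2) dom assms by metis
  then show ?thesis unfolding ext_diff_def by (simp add: algebra_simps)
qed

lemma ext_diff_pos: "u \<in> dom_pos \<Longrightarrow> ext_diff u = ext u"
  using ext_diff_eq[of u 0] ext_E(1)[of 0] by (simp add: ext_0 E_closed)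

lemma pprt_mem_dom_pos:
  assumes "x \<in> natural_domain E f"
  shows "pprt x \<in> dom_pos" "pprt (- x) \<in> dom_pos"
proof -
  obtain u v where "u \<in> dom_pos" "v \<in> dom_pos" "x = u - v"
    using assms by (auto simp: natural_domain_def natural_domain_pos_eq)
  then show "pprt x \<in> dom_pos" "pprt (- x) \<in> dom_pos"
    using dom_pos_pprt[of u v] dom_pos_pprt[of v u] by simp_all
qed

lemma natural_domainI:
  "u \<in> dom_pos \<Longrightarrow> v \<in> dom_pos \<Longrightarrow> u - v \<in> natural_domain E f"
  by (auto simp: natural_domain_def natural_domain_pos_eq)

lemma natural_domainE:
  assumes "x \<in> natural_domain E f"
  obtains u v where "u \<in> dom_pos" "v \<in> dom_pos" "x = u - v"
  using assms by (auto simp: natural_domain_def natural_domain_pos_eq)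

lemma dom_pos_natural_domain: "u \<in> dom_pos \<Longrightarrow> u \<in> natural_domain E f"
  using natural_domainI[of u 0] ext_E(1)[of 0] by (simp add: E_closed)

lemma natural_domain_nonneg: "x \<in> natural_domain E f \<Longrightarrow> 0 \<le> x \<Longrightarrow> x \<in> dom_pos"
  using pprt_mem_dom_pos(1) by fastforce

lemma E_subset_natural_domain: "E \<subseteq> natural_domain E f"
proof
  fix x assume x: "x \<in> E"
  have "pprt x \<in> E" "pprt (- x) \<in> E" using x by (auto simp: pprt_def E_closed)
  then have "pprt x - pprt (- x) \<in> natural_domain E f" by (intro natural_domainI ext_E(1)) auto
  then show "x \<in> natural_domain E f" by (simp only: pprt_diff_pprt_minus)
qed

lemma ext_diff_E: "x \<in> E \<Longrightarrow> ext_diff x = f x"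
proof -
  assume x: "x \<in> E"
  then have "pprt x \<in> E" "pprt (- x) \<in> E" by (auto simp: pprt_def E_closed)
  then show ?thesis
    unfolding ext_diff_def using f_lin(5)[of "pprt x" "pprt (- x)"]
    by (simp add: ext_E pprt_diff_pprt_minus)
qed

lemma natural_domain_dense: "order_dense_in (natural_domain E f) UNIV"
  using dense E_subset_natural_domain unfolding order_dense_in_def by blast

lemma ext_diff_add:
  assumes "x \<in> natural_domain E f" "y \<in> natural_domain E f"
  shows "x + y \<in> natural_domain E f" "ext_diff (x + y) = ext_diff x + ext_diff y"
proof -
  obtain u v where uv: "u \<in> dom_pos" "v \<in> dom_pos" "x = u - v" using assms(1) by (rule natural_domainE)
  obtain p q where pq: "p \<in> dom_pos" "q \<in> dom_pos" "y = p - q" using assms(2) by (rule natural_domainE)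
  have eq: "x + y = (u + p) - (v + q)" by (simp add: uv pq)
  show "x + y \<in> natural_domain E f"
    unfolding eq by (intro natural_domainI ext_add uv pq)
  show "ext_diff (x + y) = ext_diff x + ext_diff y"
    unfolding eq using ext_diff_eq[OF ext_add(1)[OF uv(1) pq(1)] ext_add(1)[OF uv(2) pq(2)]] uv pq
    by (simp add: ext_diff_eq ext_add)
qed

lemma ext_diff_scaleR:
  assumes "x \<in> natural_domain E f"
  shows "c *\<^sub>R x \<in> natural_domain E f" "ext_diff (c *\<^sub>R x) = c *\<^sub>R ext_diff x"
proof -
  obtain u v where uv: "u \<in> dom_pos" "v \<in> dom_pos" "x = u - v" using assms(1) by (rule natural_domainE)
  have "c *\<^sub>R x \<in> natural_domain E f \<and> ext_diff (c *\<^sub>R x) = c *\<^sub>R ext_diff x"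
  proof (cases "0 \<le> c")
    case True
    have eq: "c *\<^sub>R x = c *\<^sub>R u - c *\<^sub>R v" by (simp add: uv scaleR_diff_right)
    show ?thesis unfolding eq
      using natural_domainI[of "c *\<^sub>R u" "c *\<^sub>R v"] ext_scaleR[OF uv(1) True] ext_scaleR[OF uv(2) True]
      by (simp add: ext_diff_eq uv scaleR_diff_right)
  next
    case False
    then have c: "0 \<le> - c" by simp
    have eq: "c *\<^sub>R x = (- c) *\<^sub>R v - (- c) *\<^sub>R u" by (simp add: uv scaleR_diff_right)
    show ?thesis unfolding eq
      using natural_domainI[of "(- c) *\<^sub>R v" "(- c) *\<^sub>R u"] ext_scaleR[OF uv(1) c] ext_scaleR[OF uv(2) c]
        ext_diff_eq[of "(- c) *\<^sub>R v" "(- c) *\<^sub>R u"]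
      by (simp add: ext_diff_eq uv scaleR_diff_right)
  qed
  then show "c *\<^sub>R x \<in> natural_domain E f" "ext_diff (c *\<^sub>R x) = c *\<^sub>R ext_diff x" by auto
qed

text \<open>Lattice operations reduce to positive parts: \<open>inf x y = x - pprt (x - y)\<close>,
  and \<open>sup x y = x + y - inf x y\<close>.\<close>

lemma natural_domain_riesz_subspace: "riesz_subspace (natural_domain E f)"
proof -
  let ?L = "natural_domain E f"
  have diff: "x - y \<in> ?L" if "x \<in> ?L" "y \<in> ?L" for x y
    using ext_diff_add(1)[OF that(1) ext_diff_scaleR(1)[OF that(2), of "-1"]] by simp
  have inf: "inf x y \<in> ?L" if "x \<in> ?L" "y \<in> ?L" for x y
  proof -
    have "pprt (x - y) \<in> ?L" using diff[OF that] by (rule dom_pos_natural_domain[OF pprt_mem_dom_pos(1)])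
    then have "x - pprt (x - y) \<in> ?L" using that(1) by (intro diff)
    moreover have "x - pprt (x - y) = inf x y"
    proof -
      have "x - sup (x - y) 0 = x + inf (- (x - y)) (- 0)" by (rule diff_sup_eq_inf)
      also have "\<dots> = inf (x + (- (x - y))) (x + (- 0))" by (rule add_inf_distrib_left)
      also have "\<dots> = inf x y" by (simp add: inf.commute)
      finally show ?thesis by (simp add: pprt_def)
    qed
    ultimately show ?thesis by simp
  qed
  have sup: "sup x y \<in> ?L" if "x \<in> ?L" "y \<in> ?L" for x y
  proof -
    have "x + y - inf x y \<in> ?L" using that by (intro diff ext_diff_add(1) inf)
    then show ?thesis unfolding add_eq_inf_sup[of x y] add_diff_cancel_right' .
  qed
  have "0 \<in> ?L" using E_subset_natural_domain E_closed(1) by blast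
  then have "subspace ?L" by (intro subspaceI ext_diff_add(1) ext_diff_scaleR(1))
  then show ?thesis unfolding riesz_subspace_def by (simp add: inf sup)
qed

lemma extend_eq:
  assumes "u \<in> dom_pos" "v \<in> dom_pos"
  shows "extend E f (u - v) = ext u - ext v"
  unfolding extend_def natural_domain_pos_eq
proof (rule the_equality)
  show "\<exists>p\<in>dom_pos. \<exists>q\<in>dom_pos. u - v = p - q \<and> ext u - ext v = extend_pos E f p - extend_pos E f q"
    using assms by (auto simp: extend_pos_eq)
  fix y assume "\<exists>p\<in>dom_pos. \<exists>q\<in>dom_pos. u - v = p - q \<and> y = extend_pos E f p - extend_pos E f q"
  then obtain p q where "p \<in> dom_pos" "q \<in> dom_pos" "u - v = p - q" "y = ext p - ext q"
    by (auto simp: extend_pos_eq)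
  then show "y = ext u - ext v" using ext_diff_eq[of p q] ext_diff_eq[OF assms] by simp
qed

section \<open>Extension of Riesz homomorphisms\<close>

lemma ext_inf:
  assumes hom: "riesz_hom_on E E f" and xy: "x \<in> dom_pos" "y \<in> dom_pos"
  shows "ext (inf x y) = inf (ext x) (ext y)"
proof (rule ext_eqI)
  have "f ` below (inf x y) = {f (inf p q) |p q. p \<in> below x \<and> q \<in> below y}"
    unfolding below_inf by blast
  also have "\<dots> = {inf (f p) (f q) |p q. p \<in> below x \<and> q \<in> below y}"
    using riesz_hom_onD(2)[OF hom E(1)] unfolding below_def by (metis (lifting) mem_Collect_eq)
  also have "\<dots> = {inf p q |p q. p \<in> f ` below x \<and> q \<in> f ` below y}" by blast
  finally show "isLub UNIV (f ` below (inf x y)) (inf (ext x) (ext y))"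
    using inf_isLub_isLub[OF isLub_ext isLub_ext, OF xy] by simp
qed

text \<open>The codomain is \<open>UNIV\<close> because values are located only later, on the
  natural domain of \<open>T\<close>. Suprema follow from infima by additivity.\<close>

lemma ext_diff_riesz_hom:
  assumes hom: "riesz_hom_on E E f"
  shows "riesz_hom_on (natural_domain E f) UNIV ext_diff"
proof -
  let ?L = "natural_domain E f"
  have lin: "linear_map_on ?L UNIV ext_diff"
    using ext_diff_add(2) ext_diff_scaleR(2) by (simp add: linear_map_on_def)
  have inf: "ext_diff (inf x y) = inf (ext_diff x) (ext_diff y)" if xy: "x \<in> ?L" "y \<in> ?L" for x y
  proof -
    obtain u v where uv: "u \<in> dom_pos" "v \<in> dom_pos" "x = u - v" using xy(1) by (rule natural_domainE)
    obtain p q where pq: "p \<in> dom_pos" "q \<in> dom_pos" "y = p - q" using xy(2) by (rule natural_domainE)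
    \<comment> \<open>A common subtrahend for \<open>x\<close> and \<open>y\<close>, so that their
      infimum is an infimum in \<open>dom_pos\<close> minus \<open>?w\<close>.\<close>
    let ?w = "v + q"
    have dom: "u + q \<in> dom_pos" "p + v \<in> dom_pos" "?w \<in> dom_pos" by (intro ext_add uv pq)+
    have "inf (u + q) (p + v) \<in> dom_pos"
      using inf_greatest[OF dom(1,2)[THEN dom_pos_nonneg]] inf_le1 by (rule dom_pos_ideal[OF dom(1)])
    then have "ext_diff (inf (u + q) (p + v) - ?w) = inf (ext (u + q)) (ext (p + v)) - ext ?w"
      using ext_diff_eq[OF _ dom(3)] ext_inf[OF hom dom(1,2)] by simp
    moreover have sub: "inf a b - c = inf (a - c) (b - c)" for a b c :: 'a
      using add_inf_distrib_right[of a b "- c"] by (simp only: diff_conv_add_uminus)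
    moreover have x: "(u + q) - ?w = x" and y: "(p + v) - ?w = y" using uv(3) pq(3) by simp_all
    moreover have "ext_diff x = ext (u + q) - ext ?w" "ext_diff y = ext (p + v) - ext ?w"
      using ext_diff_eq[OF dom(1,3)] ext_diff_eq[OF dom(2,3)] unfolding x y by simp_all
    ultimately show ?thesis by simp
  qed
  have "ext_diff (sup x y) = sup (ext_diff x) (ext_diff y)" if xy: "x \<in> ?L" "y \<in> ?L" for x y
  proof -
    note L = riesz_subspaceD[OF natural_domain_riesz_subspace]
    have "ext_diff (sup x y) + ext_diff (inf x y) = ext_diff (sup x y + inf x y)"
      using L(6,7)[OF xy] by (simp add: ext_diff_add)
    also have "\<dots> = ext_diff x + ext_diff y"
      unfolding add_eq_inf_sup[of x y, symmetric] using xy by (rule ext_diff_add)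
    also have "\<dots> = sup (ext_diff x) (ext_diff y) + inf (ext_diff x) (ext_diff y)"
      by (rule add_eq_inf_sup)
    finally show ?thesis unfolding inf[OF xy] add_right_cancel .
  qed
  then show ?thesis using lin inf by (simp add: riesz_hom_on_def)
qed

end

section \<open>Expectation preserving homomorphisms\<close>

locale expectation_preserving = T: positive_operator E T + S: positive_operator E S
  for E :: "'a::riesz_space set" and T S :: "'a \<Rightarrow> 'a" +
  assumes strictly_positive: "\<And>x. x \<in> E \<Longrightarrow> 0 < x \<Longrightarrow> 0 < T x"
    and hom: "riesz_hom_on E E S"
    and preserving: "\<And>x. x \<in> E \<Longrightarrow> T (S x) = T x"
begin

lemma up_directed_image_below: "0 \<le> x \<Longrightarrow> up_directed (S ` T.below x)"
  unfolding up_directed_def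
proof (intro conjI ballI)
  assume "0 \<le> x"
  then have dir: "up_directed (T.below x)" by (rule T.below_up_directed)
  then show "S ` T.below x \<noteq> {}" by (simp add: up_directed_def)
  fix y z assume "y \<in> S ` T.below x" "z \<in> S ` T.below x"
  then obtain p q where pq: "p \<in> T.below x" "q \<in> T.below x" "y = S p" "z = S q" by blast
  then obtain r where r: "r \<in> T.below x" "p \<le> r" "q \<le> r"
    using dir unfolding up_directed_def by blast
  then have "S p \<le> S r" "S q \<le> S r" using pq by (auto simp: T.below_def intro!: S.f_mono)
  then show "\<exists>t\<in>S ` T.below x. y \<le> t \<and> z \<le> t" using pq r(1) by blast
qed

lemma image_below:
  "S ` T.below x \<subseteq> E" "y \<in> S ` T.below x \<Longrightarrow> 0 \<le> y"
  using S.f_lin(1) S.nonneg by (auto simp: T.below_def)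

lemma dom_pos_subset: "T.dom_pos \<subseteq> S.dom_pos"
proof
  fix x assume x: "x \<in> T.dom_pos"
  let ?X = "S ` T.below x"
  have x0: "0 \<le> x" using x by (rule T.dom_pos_nonneg)
  have "\<exists>b. \<forall>y\<in>?X. y \<le> b"
  proof (rule T.bounded_if_truncations_small)
    show "?X \<noteq> {}" using up_directed_image_below[OF x0] by (simp add: up_directed_def)
    show "\<And>y. y \<in> ?X \<Longrightarrow> 0 \<le> y" by (rule image_below)
    fix u assume u: "u \<in> E" "0 < u"
    show "\<exists>n::nat. \<not> isLub UNIV ((\<lambda>y. inf y (real n *\<^sub>R u)) ` ?X) (real n *\<^sub>R u)"
    proof (rule ccontr)
      assume "\<not> ?thesis"
      then have lub: "isLub UNIV ((\<lambda>y. inf y (real n *\<^sub>R u)) ` ?X) (real n *\<^sub>R u)" for n by blast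
      have "real n *\<^sub>R T u \<le> T.ext x" for n
      proof -
        \<comment> \<open>Truncation yields a set in \<open>E\<close> with supremum in
          \<open>E\<close>, where order continuity of \<open>T\<close> applies; the existence of a
          supremum of \<open>?X\<close> itself is still open here.\<close>
        let ?Y = "(\<lambda>y. inf y (real n *\<^sub>R u)) ` ?X"
        have nu: "real n *\<^sub>R u \<in> E" using u(1) by (rule T.E_closed)
        have "up_directed ?Y"
          unfolding up_directed_def
        proof (intro conjI ballI)
          show "?Y \<noteq> {}" using up_directed_image_below[OF x0] by (simp add: up_directed_def)
          fix a b assume "a \<in> ?Y" "b \<in> ?Y"
          then obtain q r where qr: "q \<in> ?X" "r \<in> ?X" "a = inf q (real n *\<^sub>R u)" "b = inf r (real n *\<^sub>R u)"
            by blast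
          then obtain t where t: "t \<in> ?X" "q \<le> t" "r \<le> t"
            using up_directed_image_below[OF x0] unfolding up_directed_def by blast
          then show "\<exists>c\<in>?Y. a \<le> c \<and> b \<le> c"
            unfolding qr by (intro bexI[of _ "inf t (real n *\<^sub>R u)"] conjI inf_mono order_refl imageI)
        qed
        moreover have "?Y \<subseteq> E" using image_below(1) nu by (auto intro: T.E_closed)
        ultimately have "isLub UNIV (T ` ?Y) (T (real n *\<^sub>R u))"
          using nu lub by (intro T.f_isLub)
        then have "T (real n *\<^sub>R u) \<le> T.ext x"
        proof (rule isLub_UNIV_least)
          fix y assume y: "y \<in> T ` ?Y"
          obtain p where p: "p \<in> T.below x" "y = T (inf (S p) (real n *\<^sub>R u))" using y by blast
          then have "p \<in> E" "S p \<in> E" by (auto simp: T.below_def S.f_lin(1))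
          then have "y \<le> T (S p)"
            unfolding p(2) using nu by (intro T.f_mono T.E_closed(7) inf_le1)
          also have "\<dots> = T p" using \<open>p \<in> E\<close> by (rule preserving)
          also have "\<dots> \<le> T.ext x" using x p(1) by (rule T.le_ext)
          finally show "y \<le> T.ext x" .
        qed
        then show ?thesis using u(1) by (simp add: T.f_lin(3))
      qed
      then have "T u \<le> 0" by (rule dedekind_complete_archimedean[OF T.dedekind])
      then show False using strictly_positive[OF u] by simp
    qed
  qed
  then show "x \<in> S.dom_pos" using x0 unfolding S.dom_pos_def by blast
qed

lemma ext_preserving:
  assumes x: "x \<in> T.dom_pos"
  shows "S.ext x \<in> T.dom_pos" "T.ext (S.ext x) = T.ext x"
proof -
  have xS: "x \<in> S.dom_pos" using x dom_pos_subset by blast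
  have "T ` S ` T.below x = T ` T.below x"
    unfolding image_image by (rule image_cong) (auto simp: T.below_def preserving)
  then have "isLub UNIV (T ` S ` T.below x) (T.ext x)" using T.isLub_ext[OF x] by simp
  then have lub: "isLub UNIV (T ` T.below (S.ext x)) (T.ext x)"
    using T.isLub_approximating[OF image_below up_directed_image_below[OF T.dom_pos_nonneg[OF x]]
        S.isLub_ext[OF xS]] by simp
  then show "T.ext (S.ext x) = T.ext x" by (rule T.ext_eqI)
  show "S.ext x \<in> T.dom_pos"
    using S.ext_nonneg[OF xS] lub unfolding T.dom_pos_def isLub_UNIV_iff by auto
qed

lemma natural_domain_ext_diff:
  assumes "u \<in> T.dom_pos" "v \<in> T.dom_pos"
  shows "S.ext_diff (u - v) = S.ext u - S.ext v"
  using assms dom_pos_subset by (intro S.ext_diff_eq) auto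

lemma ext_diff_mem:
  assumes "x \<in> natural_domain E T"
  shows "S.ext_diff x \<in> natural_domain E T"
    "extend E T (S.ext_diff x) = extend E T x"
proof -
  obtain u v where uv: "u \<in> T.dom_pos" "v \<in> T.dom_pos" "x = u - v"
    using assms by (rule T.natural_domainE)
  have eq: "S.ext_diff x = S.ext u - S.ext v" using natural_domain_ext_diff uv by simp
  show "S.ext_diff x \<in> natural_domain E T"
    unfolding eq by (intro T.natural_domainI ext_preserving uv)
  show "extend E T (S.ext_diff x) = extend E T x"
    unfolding eq using uv by (simp add: T.extend_eq ext_preserving)
qed

lemma ext_diff_extension:
  "order_continuous_riesz_hom_extension E (natural_domain E T) S S.ext_diff"
proof -
  let ?L = "natural_domain E T"
  have sub: "?L \<subseteq> natural_domain E S"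
  proof
    fix x assume "x \<in> ?L"
    then obtain u v where "u \<in> T.dom_pos" "v \<in> T.dom_pos" "x = u - v" by (rule T.natural_domainE)
    then show "x \<in> natural_domain E S" using dom_pos_subset by (auto intro: S.natural_domainI)
  qed
  \<comment> \<open>\<open>ext_diff_mem\<close> narrows the codomain from \<open>UNIV\<close> to
    \<open>?L\<close>.\<close>
  have hom': "riesz_hom_on ?L ?L S.ext_diff"
    using S.ext_diff_riesz_hom[OF hom] sub ext_diff_mem(1)
    unfolding riesz_hom_on_def linear_map_on_def by blast
  have "order_continuous_on ?L ?L S.ext_diff"
  proof (rule riesz_hom_order_continuousI[OF T.natural_domain_riesz_subspace T.natural_domain_dense hom'])
    fix X x assume X: "X \<subseteq> ?L" "\<forall>y\<in>X. 0 \<le> y" "up_directed X" and x: "x \<in> ?L" "isLub UNIV X x"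
    have dom: "y \<in> S.dom_pos" if "y \<in> ?L" "0 \<le> y" for y
      using T.natural_domain_nonneg[OF that] dom_pos_subset by blast
    obtain y where "y \<in> X" using X(3) by (auto simp: up_directed_def)
    then have "0 \<le> x" using X(2) x(2) unfolding isLub_UNIV_iff by (blast intro: order_trans)
    then have xdom: "x \<in> S.dom_pos" using x(1) by (intro dom)
    have Xdom: "X \<subseteq> S.dom_pos" using X(1,2) dom by blast
    then have "S.ext_diff ` X = S.ext ` X" by (intro image_cong) (auto intro: S.ext_diff_pos)
    then show "isLub UNIV (S.ext_diff ` X) (S.ext_diff x)"
      using S.isLub_ext_directed[OF Xdom X(3) x(2) xdom] by (simp add: S.ext_diff_pos xdom)
  qed
  then show ?thesis
    unfolding order_continuous_riesz_hom_extension_def using hom' S.ext_diff_E by blast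
qed

lemma extension_unique:
  assumes ext: "order_continuous_riesz_hom_extension E (natural_domain E T) S S'"
    and x: "x \<in> natural_domain E T"
  shows "S' x = S.ext_diff x"
proof -
  let ?L = "natural_domain E T"
  note L = T.natural_domain_riesz_subspace
  have hom': "riesz_hom_on ?L ?L S'" and cont: "order_continuous_on ?L ?L S'"
    and S': "\<And>x. x \<in> E \<Longrightarrow> S' x = S x"
    using ext by (auto simp: order_continuous_riesz_hom_extension_def)
  have lin: "linear_map_on ?L ?L S'" using hom' by (simp add: riesz_hom_on_def)
  have pos: "S' u = S.ext u" if u: "u \<in> T.dom_pos" for u
  proof -
    have u0: "0 \<le> u" using u by (rule T.dom_pos_nonneg)
    have "S' ` ?L \<subseteq> ?L" using lin by (simp add: linear_map_on_def)
    moreover have "T.below u \<subseteq> ?L" using T.E_subset_natural_domain by (auto simp: T.below_def)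
    ultimately have "isLub UNIV (S' ` T.below u) (S' u)"
      using order_continuous_on_isLub[OF L L T.natural_domain_dense cont _ riesz_hom_onD(4)[OF hom' L]]
        T.below_up_directed[OF u0] T.dom_pos_natural_domain[OF u] T.isLub_below[OF u0] by blast
    moreover have "S' ` T.below u = S ` T.below u"
      by (intro image_cong) (auto simp: T.below_def S')
    ultimately show ?thesis using S.ext_eqI by metis
  qed
  obtain u v where uv: "u \<in> T.dom_pos" "v \<in> T.dom_pos" "x = u - v"
    using x by (rule T.natural_domainE)
  have "S' x = S' u - S' v"
    unfolding uv(3) using uv(1,2) by (intro linear_map_onD(5)[OF lin L] T.dom_pos_natural_domain)
  then show ?thesis using pos uv natural_domain_ext_diff by simp
qed

end

theorem theorem9:
  fixes E :: "'a::riesz_space set" and T S :: "'a \<Rightarrow> 'a" and e :: 'a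
  assumes "conditional_expectation_preserving_system E T S e"
    and "ambient_is_universal_completion E"
  shows "\<exists>S'. order_continuous_riesz_hom_extension E (natural_domain E T) S S' \<and>
    (\<forall>S''. order_continuous_riesz_hom_extension E (natural_domain E T) S S'' \<longrightarrow>
       (\<forall>x\<in>natural_domain E T. S'' x = S' x)) \<and>
    (\<forall>x\<in>natural_domain E T. extend E T (S' x) = extend E T x)"
proof -
  have E: "riesz_subspace E" "dedekind_complete E"
    and T: "linear_map_on E E T" "\<And>x. x \<in> E \<Longrightarrow> 0 < x \<Longrightarrow> 0 < T x" "order_continuous_on E E T"
    and S: "riesz_hom_on E E S" "order_continuous_on E E S" "\<And>x. x \<in> E \<Longrightarrow> T (S x) = T x"
    using assms(1)
    by (auto simp: conditional_expectation_preserving_system_def conditional_riesz_triple_def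
        conditional_expectation_on_def)
  have Slin: "linear_map_on E E S" using S(1) by (simp add: riesz_hom_on_def)
  have zero: "0 \<in> E" using E(1) by (rule riesz_subspaceD)
  have "0 \<le> T x" if "x \<in> E" "0 \<le> x" for x
    using T(2)[OF that(1)] that(2) linear_map_onD(6)[OF T(1) E(1)] by (cases "x = 0") (auto simp: order_le_less)
  moreover have "0 \<le> S x" if "x \<in> E" "0 \<le> x" for x
    using riesz_hom_onD(4)[OF S(1) E(1) zero that] linear_map_onD(6)[OF Slin E(1)] by simp
  ultimately interpret expectation_preserving E T S
    using E T S Slin assms(2) by unfold_locales auto
  show ?thesis using ext_diff_extension extension_unique ext_diff_mem(2) by blast
qed

end
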